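(* Let $G=(V,E)$ be a generic circuit, let $s,t$ be distinct vertices of $G$ and let $e$ be an edge of $G$ incident with at least one of $s,t$. Then the following holds: (i) $G$ has a good ordering $\prec$ with corresponding branchings $B^+,B^-$ (an arc-disjoint out-branching and in-branching of $D_\prec$) in which $s$ is the root of $B^+$, $t$ is the root of $B^-$ and $e$ (as oriented in $D_\prec$) belongs to $B^+$. (ii) $G$ has a good ordering $\prec$ with corresponding branchings $B^+,B^-$ in which $s$ is the root of $B^+$, $t$ is the root of $B^-$ and $e$ belongs to $B^-$.
   Context: Graphs and digraphs may contain parallel edges and arcs, respectively, but no loops. $G[X]$ is the subgraph of $G$ induced by $X$. A graph $G=(V,E)$ is a generic circuit if (i) $|E|=2|V|-2>0$, and (ii) $|E(G[X])|\le 2|X|-3$ for every $X\subset V$ with $2\le |X|\le |V|-1$. An out-branching (respectively in-branching) of a digraph $D$ with root $r$ is a spanning subdigraph $B^+_r$ (respectively $B^-_r$) whose arcs form a spanning tree of the underlying graph and in which every vertex $v\ne r$ has precisely one entering (respectively leaving) arc and $r$ has no entering (respectively leaving) arc. For a vertex ordering (total order) $\prec$ of a graph $G$, $D_\prec$ is the acyclic orientation of $G$ in which each edge $uv$ is oriented from $u$ to $v$ if and only if $u\prec v$. The ordering $\prec$ is good if $D_\prec$ contains an out-branching and an in-branching that are arc-disjoint. *)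

theory Defs
  imports "Graph_Theory.Digraph_Component"
begin

section \<open>Undirected multigraphs\<close>

text \<open>
  Edges are abstract identifiers, so parallel edges are distinct edges with the same set of ends.
\<close>

record ('v, 'e) multigraph =
  mg_verts :: "'v set"
  mg_edges :: "'e set"
  mg_ends :: "'e \<Rightarrow> 'v set"

locale fin_multigraph =
  fixes G :: "('v, 'e) multigraph" (structure)
  assumes finite_mg_verts: "finite (mg_verts G)"
    and finite_mg_edges: "finite (mg_edges G)"
    and mg_ends_in_verts: "e \<in> mg_edges G \<Longrightarrow> mg_ends G e \<subseteq> mg_verts G"
    and card_mg_ends: "e \<in> mg_edges G \<Longrightarrow> card (mg_ends G e) = 2"

definition mg_induced :: "('v, 'e) multigraph \<Rightarrow> 'v set \<Rightarrow> ('v, 'e) multigraph" where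
  "mg_induced G X =
     \<lparr>mg_verts = X, mg_edges = {e \<in> mg_edges G. mg_ends G e \<subseteq> X}, mg_ends = mg_ends G\<rparr>"

text \<open>The arithmetic is done on \<^typ>\<open>int\<close> to avoid truncated subtraction.\<close>

definition generic_circuit :: "('v, 'e) multigraph \<Rightarrow> bool" where
  "generic_circuit G \<longleftrightarrow>
     fin_multigraph G \<and>
     int (card (mg_edges G)) = 2 * int (card (mg_verts G)) - 2 \<and>
     2 * int (card (mg_verts G)) - 2 > 0 \<and>
     (\<forall>X. X \<subset> mg_verts G \<and> 2 \<le> int (card X) \<and> int (card X) \<le> int (card (mg_verts G)) - 1 \<longrightarrow>
        int (card (mg_edges (mg_induced G X))) \<le> 2 * int (card X) - 3)"

definition mg_adj :: "('v, 'e) multigraph \<Rightarrow> ('v \<times> 'v) set" where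
  "mg_adj G = {(u, v). \<exists>e \<in> mg_edges G. mg_ends G e = {u, v}}"

definition mg_connected :: "('v, 'e) multigraph \<Rightarrow> bool" where
  "mg_connected G \<longleftrightarrow>
     mg_verts G \<noteq> {} \<and> (\<forall>u \<in> mg_verts G. \<forall>v \<in> mg_verts G. (u, v) \<in> (mg_adj G)\<^sup>*)"

text \<open>
  A cycle visits the vertices \<open>vs\<close> cyclically, using the \<open>i\<close>-th edge of \<open>es\<close> between the \<open>i\<close>-th
  vertex and its successor. Two parallel edges form a cycle of length 2.
\<close>

definition mg_cycle :: "('v, 'e) multigraph \<Rightarrow> 'v list \<Rightarrow> 'e list \<Rightarrow> bool" where
  "mg_cycle G vs es \<longleftrightarrow>
     length vs = length es \<and> length es \<ge> 2 \<and> distinct vs \<and> distinct es \<and>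
     set vs \<subseteq> mg_verts G \<and> set es \<subseteq> mg_edges G \<and>
     (\<forall>i < length es. mg_ends G (es ! i) = {vs ! i, vs ! (Suc i mod length vs)})"

definition mg_tree :: "('v, 'e) multigraph \<Rightarrow> bool" where
  "mg_tree T \<longleftrightarrow> fin_multigraph T \<and> mg_connected T \<and> \<not> (\<exists>vs es. mg_cycle T vs es)"

definition mg_spanning_tree :: "('v, 'e) multigraph \<Rightarrow> ('v, 'e) multigraph \<Rightarrow> bool" where
  "mg_spanning_tree T G \<longleftrightarrow>
     mg_verts T = mg_verts G \<and> mg_edges T \<subseteq> mg_edges G \<and>
     (\<forall>e \<in> mg_edges T. mg_ends T e = mg_ends G e) \<and> mg_tree T"

section \<open>Branchings\<close>

definition underlying :: "('v, 'e) pre_digraph \<Rightarrow> ('v, 'e) multigraph" where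
  "underlying D =
     \<lparr>mg_verts = verts D, mg_edges = arcs D, mg_ends = (\<lambda>a. {tail D a, head D a})\<rparr>"

text \<open>
  The library predicate \<^const>\<open>spanning_tree\<close> only excludes directed cycles, which says nothing
  about subdigraphs of an acyclic digraph; hence trees are taken in the underlying multigraph.
\<close>

definition out_branching :: "('v, 'e) pre_digraph \<Rightarrow> ('v, 'e) pre_digraph \<Rightarrow> 'v \<Rightarrow> bool" where
  "out_branching D B r \<longleftrightarrow>
     spanning B D \<and> mg_spanning_tree (underlying B) (underlying D) \<and>
     r \<in> verts D \<and> (\<forall>v \<in> verts D - {r}. in_degree B v = 1) \<and> in_arcs B r = {}"

definition in_branching :: "('v, 'e) pre_digraph \<Rightarrow> ('v, 'e) pre_digraph \<Rightarrow> 'v \<Rightarrow> bool" where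
  "in_branching D B r \<longleftrightarrow>
     spanning B D \<and> mg_spanning_tree (underlying B) (underlying D) \<and>
     r \<in> verts D \<and> (\<forall>v \<in> verts D - {r}. out_degree B v = 1) \<and> out_arcs B r = {}"

section \<open>Good orderings\<close>

definition vertex_ordering :: "('v, 'e) multigraph \<Rightarrow> ('v \<times> 'v) set \<Rightarrow> bool" where
  "vertex_ordering G R \<longleftrightarrow>
     R \<subseteq> mg_verts G \<times> mg_verts G \<and> strict_linear_order_on (mg_verts G) R"

definition orientation :: "('v, 'e) multigraph \<Rightarrow> ('v \<times> 'v) set \<Rightarrow> ('v, 'e) pre_digraph" where
  "orientation G R =
     \<lparr>verts = mg_verts G, arcs = mg_edges G,
      tail = (\<lambda>e. THE u. \<exists>v. mg_ends G e = {u, v} \<and> (u, v) \<in> R),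
      head = (\<lambda>e. THE v. \<exists>u. mg_ends G e = {u, v} \<and> (u, v) \<in> R)\<rparr>"

lemma orientation_arc_iff:
  assumes "fin_multigraph G" "vertex_ordering G R" "e \<in> mg_edges G"
  shows "tail (orientation G R) e = u \<and> head (orientation G R) e = v \<longleftrightarrow>
         mg_ends G e = {u, v} \<and> (u, v) \<in> R"
proof -
  interpret fin_multigraph G by fact
  have R: "trans R" "irrefl R" "total_on (mg_verts G) R"
    using assms(2) by (auto simp: vertex_ordering_def strict_linear_order_on_def)
  obtain x y where xy: "mg_ends G e = {x, y}" "x \<noteq> y"
    using card_mg_ends[OF assms(3)] by (auto simp: card_2_iff)
  then have "x \<in> mg_verts G" "y \<in> mg_verts G"
    using mg_ends_in_verts[OF assms(3)] by auto
  then have "(x, y) \<in> R \<or> (y, x) \<in> R"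
    using R(3) xy(2) by (auto simp: total_on_def)
  then obtain a b where ab: "mg_ends G e = {a, b}" "(a, b) \<in> R"
    using xy(1) by (metis insert_commute)
  have uniq: "p = a \<and> q = b" if "mg_ends G e = {p, q}" "(p, q) \<in> R" for p q
  proof -
    have "\<not> (p = b \<and> q = a)"
      using that(2) ab(2) R(1,2) by (meson irrefl_def transD)
    then show ?thesis
      using that(1) ab(1) by (auto simp: doubleton_eq_iff)
  qed
  have "(THE u. \<exists>v. mg_ends G e = {u, v} \<and> (u, v) \<in> R) = a"
    using ab uniq by (intro the_equality) blast+
  moreover have "(THE v. \<exists>u. mg_ends G e = {u, v} \<and> (u, v) \<in> R) = b"
    using ab uniq by (intro the_equality) blast+
  ultimately have "tail (orientation G R) e = a" "head (orientation G R) e = b"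
    by (simp_all add: orientation_def)
  then show ?thesis
    using ab uniq by metis
qed

definition good_branchings ::
    "('v, 'e) pre_digraph \<Rightarrow> ('v, 'e) pre_digraph \<Rightarrow> 'v \<Rightarrow> ('v, 'e) pre_digraph \<Rightarrow> 'v \<Rightarrow> bool" where
  "good_branchings D Bp s Bm t \<longleftrightarrow>
     out_branching D Bp s \<and> in_branching D Bm t \<and> arcs Bp \<inter> arcs Bm = {}"

definition good_ordering :: "('v, 'e) multigraph \<Rightarrow> ('v \<times> 'v) set \<Rightarrow> bool" where
  "good_ordering G R \<longleftrightarrow>
     vertex_ordering G R \<and> (\<exists>Bp s Bm t. good_branchings (orientation G R) Bp s Bm t)"

end

theory Submission
  imports Defs Complex_Main
begin

text \<open>
  In an acyclic digraph, any choice of one entering arc at every vertex other than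
  \<open>s\<close> is an out-branching with root \<open>s\<close>. Since a generic circuit has
  exactly as many edges as two branchings, a good ordering with roots \<open>s\<close> and
  \<open>t\<close> amounts to an injective position function together with an edge set
  \<open>T\<close> such that the upper end maps \<open>T\<close> bijectively onto the vertices
  other than \<open>s\<close>, and the lower end maps the edges outside \<open>T\<close>
  bijectively onto the vertices other than \<open>t\<close> (\<open>branching_system\<close>).
  Reversing the order exchanges \<open>s\<close> and \<open>t\<close> and exchanges
  \<open>T\<close> with its complement. Since \<open>s\<close> comes first, all edges at
  \<open>s\<close> but one belong to \<open>T\<close>. Hence the theorem follows once the
  exceptional edge at \<open>s\<close> can be prescribed
  (\<open>circuit_has_branching_system\<close>), which is proved by induction on the number of
  vertices.

  If the circuit has a 2-separation with cut \<open>{u, v}\<close>, adding an edge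
  \<open>uv\<close> to each side gives two smaller circuits. In suitable systems of both, the two
  new edges have the same direction, and exactly one of them lies in its set \<open>T\<close>.
  Deleting them leaves each demand for an entering or a leaving edge satisfied exactly once
  (\<open>glue_systems\<close>). Prescribing the exceptional edge is what allows the second new
  edge to be matched to the first.

  Otherwise, a vertex \<open>z\<close> of degree 3 is removed and an edge \<open>xy\<close> is put
  between two of its neighbours. A system of the smaller graph always extends to \<open>z\<close>
  (\<open>insert_vertex_on_edge\<close>), so it remains to find a \<open>z\<close> that differs
  from \<open>s\<close>, \<open>t\<close> and the other end of the prescribed edge, and for which
  the smaller graph is a circuit again; call such a degree 3 vertex admissible. Unless there are
  only four vertices, a 3-connected circuit has four admissible vertices or three pairwise
  nonadjacent ones (\<open>exists_admissible\<close>), as Berg and Jordan showed. The reason is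
  that the critical sets which make a vertex \<open>z\<close> inadmissible have complements that
  form three pairwise nonadjacent branches at \<open>z\<close> (\<open>blockers_cover\<close>),
  and each branch, if chosen maximal, contains an admissible vertex
  (\<open>admissible_in_minimal_branch\<close>).
\<close>

section \<open>Branching systems\<close>

text \<open>
  \<open>lo\<close> and \<open>hi\<close> give the ends of an edge with the smaller and the larger
  position. The edges of \<open>T\<close> form the out-branching: each is the entering edge of its
  upper end. The other edges form the in-branching: each is the leaving edge of its lower end.
  Positions are real numbers so that a vertex can be inserted between any two others.
\<close>

definition branching_system ::
    "('v, 'e) multigraph \<Rightarrow> 'v \<Rightarrow> 'v \<Rightarrow> 'e set \<Rightarrow> ('e \<Rightarrow> 'v) \<Rightarrow> ('e \<Rightarrow> 'v) \<Rightarrow> ('v \<Rightarrow> real) \<Rightarrow> bool" where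
  "branching_system G s t T lo hi pos \<longleftrightarrow>
     T \<subseteq> mg_edges G \<and> inj_on pos (mg_verts G) \<and>
     (\<forall>e\<in>mg_edges G. mg_ends G e = {lo e, hi e} \<and> pos (lo e) < pos (hi e)) \<and>
     bij_betw hi T (mg_verts G - {s}) \<and> bij_betw lo (mg_edges G - T) (mg_verts G - {t})"

lemma branching_system_reverse:
  assumes "branching_system G s t T lo hi pos"
  shows "branching_system G t s (mg_edges G - T) hi lo (\<lambda>v. - pos v)"
proof -
  have "mg_edges G - (mg_edges G - T) = T"
    using assms by (auto simp: branching_system_def)
  then show ?thesis
    using assms by (auto simp: branching_system_def inj_on_def)
qed

text \<open>
  Following the edge to the parent strictly decreases \<open>pos\<close>, so every vertex is
  connected to the root. The statement serves out-branchings directly, and in-branchings with the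
  negated position.
\<close>

lemma mg_tree_of_parents:
  fixes pos :: "'v \<Rightarrow> real"
  assumes fin: "finite V" "finite T" and r: "r \<in> V"
    and bij: "bij_betw hi T (V - {r})"
    and ends: "\<And>e. e \<in> T \<Longrightarrow> ends e = {lo e, hi e} \<and> lo e \<in> V \<and> pos (lo e) < pos (hi e)"
  shows "mg_tree \<lparr>mg_verts = V, mg_edges = T, mg_ends = ends\<rparr>" (is "mg_tree ?T")
proof -
  have hiV: "hi e \<in> V" if "e \<in> T" for e
    using bij that by (auto simp: bij_betw_def)
  have "fin_multigraph ?T"
  proof
    show "finite (mg_verts ?T)" "finite (mg_edges ?T)"
      using fin by simp_all
    fix e assume "e \<in> mg_edges ?T"
    then have "mg_ends ?T e = {lo e, hi e}" "lo e \<noteq> hi e" "lo e \<in> V" "hi e \<in> V"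
      using ends[of e] hiV[of e] by auto
    then show "mg_ends ?T e \<subseteq> mg_verts ?T" "card (mg_ends ?T e) = 2"
      by simp_all
  qed
  moreover have "mg_connected ?T"
  proof -
    let ?R = "(mg_adj ?T)\<^sup>*"
    have root: "(r, v) \<in> ?R" if "v \<in> V" for v
      using that
    proof (induction "card {x \<in> V. pos x < pos v}" arbitrary: v rule: less_induct)
      case less
      show ?case
      proof (cases "v = r")
        case False
        then obtain e where e: "e \<in> T" "hi e = v"
          using bij less.prems by (metis bij_betw_imp_surj_on Diff_iff imageE singletonD)
        have "{x \<in> V. pos x < pos (lo e)} \<subset> {x \<in> V. pos x < pos v}"
          using ends[OF e(1)] e(2) by auto
        then have "card {x \<in> V. pos x < pos (lo e)} < card {x \<in> V. pos x < pos v}"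
          using fin(1) by (simp add: psubset_card_mono)
        then have "(r, lo e) \<in> ?R"
          using less.hyps ends[OF e(1)] by blast
        moreover have "(lo e, v) \<in> mg_adj ?T"
          using e ends[OF e(1)] by (auto simp: mg_adj_def)
        ultimately show ?thesis
          by (rule rtrancl_into_rtrancl)
      qed simp
    qed
    have "sym (mg_adj ?T)"
      by (auto simp: sym_def mg_adj_def insert_commute)
    then have "sym ?R"
      by (rule sym_rtrancl)
    then have "(u, v) \<in> ?R" if "u \<in> V" "v \<in> V" for u v
      using root[OF that(1)] root[OF that(2)] by (meson rtrancl_trans symE)
    then show ?thesis
      using r by (auto simp: mg_connected_def)
  qed
  moreover have "\<not> mg_cycle ?T vs es" for vs es
  proof
    assume cyc: "mg_cycle ?T vs es"
    define n where "n = length es"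
    have n: "n \<ge> 2" "length vs = n" "distinct vs" "distinct es" "set es \<subseteq> T"
      and ith: "\<And>i. i < n \<Longrightarrow> ends (es ! i) = {vs ! i, vs ! (Suc i mod n)}"
      using cyc by (auto simp: mg_cycle_def n_def)
    \<comment> \<open>At the highest vertex of the cycle both cycle edges arrive from below, but only one edge
        of \<open>T\<close> has a given upper end.\<close>
    obtain j where j: "j < n" "\<And>i. i < n \<Longrightarrow> pos (vs ! i) \<le> pos (vs ! j)"
    proof -
      have "finite ((\<lambda>i. pos (vs ! i)) ` {..<n})" "(\<lambda>i. pos (vs ! i)) ` {..<n} \<noteq> {}"
        using n(1) by (auto simp: lessThan_empty_iff)
      from Max_in[OF this] obtain j where "j < n" "Max ((\<lambda>i. pos (vs ! i)) ` {..<n}) = pos (vs ! j)"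
        by auto
      then show thesis
        using that[of j] Max_ge[of "(\<lambda>i. pos (vs ! i)) ` {..<n}"] by (metis finite_imageI finite_lessThan imageI lessThan_iff)
    qed
    define p where "p = (if j = 0 then n - 1 else j - 1)"
    have p: "p < n" "p \<noteq> j" "Suc p mod n = j"
      using n(1) j(1) by (auto simp: p_def)
    have top: "hi (es ! k) = vs ! j" if k: "k < n" "vs ! j \<in> ends (es ! k)" for k
    proof (rule ccontr)
      assume ne: "hi (es ! k) \<noteq> vs ! j"
      have kT: "es ! k \<in> T"
        using n(5) k(1) by (auto simp: n_def)
      then have lo: "lo (es ! k) = vs ! j"
        using ends[OF kT] ne k(2) by auto
      have "hi (es ! k) \<in> {vs ! k, vs ! (Suc k mod n)}"
        using ith[OF k(1)] ends[OF kT] by auto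
      moreover have "Suc k mod n < n"
        using n(1) by simp
      ultimately have "pos (hi (es ! k)) \<le> pos (vs ! j)"
        using j(2) k(1) by auto
      then show False
        using ends[OF kT] lo by simp
    qed
    have "hi (es ! j) = hi (es ! p)"
      using top[OF j(1)] top[OF p(1)] ith[OF j(1)] ith[OF p(1)] p(3) by simp
    moreover have "es ! j \<in> T" "es ! p \<in> T"
      using n(5) j(1) p(1) by (auto simp: n_def)
    ultimately have "es ! j = es ! p"
      using bij by (auto simp: bij_betw_def inj_on_def)
    then show False
      using n(4) j(1) p(1,2) by (simp add: nth_eq_iff_index_eq n_def)
  qed
  ultimately show ?thesis
    by (auto simp: mg_tree_def)
qed

lemma good_branchings_of_system:
  assumes G: "fin_multigraph G" and st: "s \<in> mg_verts G" "t \<in> mg_verts G"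
    and sys: "branching_system G s t T lo hi pos"
  obtains R Bp Bm where "good_ordering G R" "good_branchings (orientation G R) Bp s Bm t"
    "arcs Bp = T" "arcs Bm = mg_edges G - T"
proof -
  interpret fin_multigraph G by fact
  let ?V = "mg_verts G" and ?E = "mg_edges G"
  define R where "R = {(u, v). u \<in> ?V \<and> v \<in> ?V \<and> pos u < pos v}"
  let ?D = "orientation G R"
  have inj: "inj_on pos ?V" and TE: "T \<subseteq> ?E"
    and ends: "\<And>e. e \<in> ?E \<Longrightarrow> mg_ends G e = {lo e, hi e}" "\<And>e. e \<in> ?E \<Longrightarrow> pos (lo e) < pos (hi e)"
    and bijT: "bij_betw hi T (?V - {s})" and bijU: "bij_betw lo (?E - T) (?V - {t})"
    using sys by (auto simp: branching_system_def)
  have inV: "lo e \<in> ?V" "hi e \<in> ?V" if "e \<in> ?E" for e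
    using mg_ends_in_verts[OF that] ends(1)[OF that] by auto
  have R: "vertex_ordering G R"
    using inj by (fastforce simp: vertex_ordering_def R_def strict_linear_order_on_def trans_def
        irrefl_def total_on_def inj_on_def)
  have th: "tail ?D e = lo e" "head ?D e = hi e" if "e \<in> ?E" for e
    using orientation_arc_iff[OF G R that, of "lo e" "hi e"] ends[OF that] inV[OF that]
    by (auto simp: R_def)
  have D: "verts ?D = ?V" "arcs ?D = ?E"
    by (simp_all add: orientation_def)
  have span: "spanning (?D\<lparr>arcs := F\<rparr>) ?D" if "F \<subseteq> ?E" for F
    using that D th inV
    by (auto simp: spanning_def subgraph_def compatible_def wf_digraph_def subset_iff)
  have tree: "mg_spanning_tree (underlying (?D\<lparr>arcs := F\<rparr>)) (underlying ?D)"
    if "F \<subseteq> ?E" "mg_tree \<lparr>mg_verts = ?V, mg_edges = F, mg_ends = \<lambda>a. {tail ?D a, head ?D a}\<rparr>" for F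
    using that D by (simp add: mg_spanning_tree_def underlying_def)
  have finT: "finite T" "finite (?E - T)"
    using TE finite_mg_edges by (auto intro: finite_subset)
  define Bp where "Bp = ?D\<lparr>arcs := T\<rparr>"
  define Bm where "Bm = ?D\<lparr>arcs := ?E - T\<rparr>"
  have "mg_tree \<lparr>mg_verts = ?V, mg_edges = T, mg_ends = \<lambda>a. {tail ?D a, head ?D a}\<rparr>"
    using TE th ends(2) inV
    by (intro mg_tree_of_parents[OF finite_mg_verts finT(1) st(1) bijT, where lo = lo and pos = pos]) auto
  moreover have "{a \<in> T. head ?D a = v} = {a \<in> T. hi a = v}" for v
    using TE th by auto
  then have inarcs: "in_arcs Bp v = {a \<in> T. hi a = v}" for v
    by (auto simp: in_arcs_def Bp_def)
  moreover have "card {a \<in> T. hi a = v} = 1" if v: "v \<in> ?V - {s}" for v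
  proof -
    obtain a where "a \<in> T" "hi a = v"
      using bijT v by (metis bij_betw_imp_surj_on imageE)
    then have "{a \<in> T. hi a = v} = {a}"
      using bijT by (auto simp: bij_betw_def inj_on_def)
    then show ?thesis by simp
  qed
  moreover have "{a \<in> T. hi a = s} = {}"
    using bijT by (auto simp: bij_betw_def)
  ultimately have out: "out_branching ?D Bp s"
    using span[OF TE] tree[OF TE] D st by (simp add: out_branching_def in_degree_def Bp_def)
  have "mg_tree \<lparr>mg_verts = ?V, mg_edges = ?E - T, mg_ends = \<lambda>a. {tail ?D a, head ?D a}\<rparr>"
    using th ends(2) inV
    by (intro mg_tree_of_parents[OF finite_mg_verts finT(2) st(2) bijU, where lo = hi and pos = "\<lambda>v. - pos v"]) auto
  moreover have "{a \<in> ?E - T. tail ?D a = v} = {a \<in> ?E - T. lo a = v}" for v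
    using th by auto
  then have outarcs: "out_arcs Bm v = {a \<in> ?E - T. lo a = v}" for v
    by (auto simp: out_arcs_def Bm_def)
  moreover have "card {a \<in> ?E - T. lo a = v} = 1" if v: "v \<in> ?V - {t}" for v
  proof -
    obtain a where "a \<in> ?E - T" "lo a = v"
      using bijU v by (metis bij_betw_imp_surj_on imageE)
    then have "{a \<in> ?E - T. lo a = v} = {a}"
      using bijU by (auto simp: bij_betw_def inj_on_def)
    then show ?thesis by simp
  qed
  moreover have "{a \<in> ?E - T. lo a = t} = {}"
    using bijU by (auto simp: bij_betw_def)
  ultimately have inb: "in_branching ?D Bm t"
    using span[of "?E - T"] tree[of "?E - T"] D st by (simp add: in_branching_def out_degree_def Bm_def)
  have "good_branchings ?D Bp s Bm t"
    using out inb by (auto simp: good_branchings_def Bp_def Bm_def)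
  moreover from this have "good_ordering G R"
    using R by (auto simp: good_ordering_def)
  ultimately show thesis
    using that by (simp add: Bp_def Bm_def)
qed

lemma bij_betw_singletons: "bij_betw f {a} {f a}"
  by (simp add: bij_betw_def)

lemma system_edges:
  assumes "branching_system G s t T lo hi pos"
  shows "T \<subseteq> mg_edges G" "inj_on pos (mg_verts G)"
    "\<And>e. e \<in> mg_edges G \<Longrightarrow> mg_ends G e = {lo e, hi e}"
    "\<And>e. e \<in> mg_edges G \<Longrightarrow> pos (lo e) < pos (hi e)"
    "bij_betw hi T (mg_verts G - {s})" "bij_betw lo (mg_edges G - T) (mg_verts G - {t})"
  using assms by (simp_all add: branching_system_def)

text \<open>
  The lowest vertex cannot have an entering edge, so it has to be the root.
\<close>

lemma out_root_first:
  assumes G: "fin_multigraph G" and sys: "branching_system G s t T lo hi pos" and v: "v \<in> mg_verts G"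
  shows "pos s \<le> pos v"
proof -
  interpret fin_multigraph G by fact
  note sys = system_edges[OF sys]
  let ?P = "pos ` mg_verts G"
  have P: "finite ?P" "?P \<noteq> {}"
    using finite_mg_verts v by auto
  obtain m where m: "m \<in> mg_verts G" "pos m = Min ?P"
    using Min_in[OF P] by auto
  have le: "pos m \<le> pos x" if "x \<in> mg_verts G" for x
    using m(2) Min_le[OF P(1)] that by simp
  have "m = s"
  proof (rule ccontr)
    assume "m \<noteq> s"
    then obtain e where e: "e \<in> T" "hi e = m"
      using sys(5) m(1) by (metis Diff_iff bij_betw_imp_surj_on imageE singletonD)
    then have "lo e \<in> mg_verts G" "pos (lo e) < pos m"
      using sys(1,3,4) mg_ends_in_verts by auto
    then show False
      using le by force
  qed
  then show ?thesis
    using le[OF v] by simp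
qed

lemma in_root_last:
  assumes "fin_multigraph G" "branching_system G s t T lo hi pos" "v \<in> mg_verts G"
  shows "pos v \<le> pos t"
  using out_root_first[OF assms(1) branching_system_reverse[OF assms(2)] assms(3)] by simp

lemma edge_at_out_root:
  assumes G: "fin_multigraph G" and sys: "branching_system G s t T lo hi pos"
    and e: "e \<in> mg_edges G" "s \<in> mg_ends G e"
  shows "lo e = s"
proof (rule ccontr)
  assume "lo e \<noteq> s"
  then have "hi e = s" "pos (lo e) < pos s"
    using system_edges(3,4)[OF sys e(1)] e(2) by auto
  moreover have "lo e \<in> mg_verts G"
    using fin_multigraph.mg_ends_in_verts[OF G e(1)] system_edges(3)[OF sys e(1)] by simp
  ultimately show False
    using out_root_first[OF G sys] by fastforce
qed

lemma edge_at_in_root: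
  assumes "fin_multigraph G" "branching_system G s t T lo hi pos"
    and "e \<in> mg_edges G" "t \<in> mg_ends G e"
  shows "hi e = t"
  using edge_at_out_root[OF assms(1) branching_system_reverse[OF assms(2)] assms(3,4)] .

text \<open>
  Every edge at the first vertex leaves it, and only one edge outside \<open>T\<close> leaves any
  given vertex.
\<close>

lemma other_edges_at_out_root:
  assumes G: "fin_multigraph G" and sys: "branching_system G s t T lo hi pos"
    and e: "e \<in> mg_edges G" "s \<in> mg_ends G e" and f: "f \<in> mg_edges G" "s \<in> mg_ends G f"
    and "f \<notin> T" "e \<noteq> f"
  shows "e \<in> T"
  using edge_at_out_root[OF G sys e] edge_at_out_root[OF G sys f] system_edges(6)[OF sys] e(1) f(1) assms(7,8)
  by (auto simp: bij_betw_def inj_on_def)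

section \<open>Edge counts in generic circuits\<close>

locale circuit =
  fixes G :: "('v, 'e) multigraph"
  assumes circuit: "generic_circuit G"
begin

abbreviation "V \<equiv> mg_verts G"
abbreviation "E \<equiv> mg_edges G"
abbreviation "ends \<equiv> mg_ends G"

sublocale fin_multigraph G
  using circuit by (simp add: generic_circuit_def)

definition edges_in :: "'v set \<Rightarrow> 'e set" where
  "edges_in X = {e \<in> E. ends e \<subseteq> X}"

definition edge_count :: "'v set \<Rightarrow> int" where
  "edge_count X = int (card (edges_in X))"

definition nbrs :: "'v \<Rightarrow> 'v set" where
  "nbrs z = {v. \<exists>e\<in>E. ends e = {z, v}}"

text \<open>
  Critical sets attain the sparsity bound of a circuit; in rigidity terms, they induce minimally
  rigid subgraphs.
\<close>

definition critical :: "'v set \<Rightarrow> bool" where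
  "critical X \<longleftrightarrow> X \<subset> V \<and> 2 \<le> card X \<and> edge_count X = 2 * int (card X) - 3"

lemma finite_edges_in [simp]: "finite (edges_in X)"
  using finite_mg_edges by (simp add: edges_in_def)

lemma edge_ends:
  assumes "e \<in> E"
  obtains u v where "ends e = {u, v}" "u \<noteq> v" "u \<in> V" "v \<in> V"
  using card_mg_ends[OF assms] mg_ends_in_verts[OF assms] by (auto simp: card_2_iff)

lemma card_V: "2 \<le> card V"
  using circuit by (simp add: generic_circuit_def)

lemma edge_count_V: "edge_count V = 2 * int (card V) - 2"
proof -
  have "edges_in V = E"
    using mg_ends_in_verts by (auto simp: edges_in_def)
  then show ?thesis
    using circuit by (simp add: generic_circuit_def edge_count_def)
qed

lemma edge_count_le:
  assumes "X \<subset> V" "2 \<le> card X"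
  shows "edge_count X \<le> 2 * int (card X) - 3"
proof -
  have "card X < card V"
    using assms(1) finite_mg_verts by (rule psubset_card_mono[rotated])
  then have "int (card (mg_edges (mg_induced G X))) \<le> 2 * int (card X) - 3"
    using circuit assms unfolding generic_circuit_def by auto
  then show ?thesis
    by (simp add: edge_count_def edges_in_def mg_induced_def)
qed

lemma finite_sub [simp]: "X \<subseteq> V \<Longrightarrow> finite X"
  using finite_mg_verts by (rule finite_subset[rotated])

lemma edges_in_small:
  assumes "finite X" "card X \<le> 1"
  shows "edges_in X = {}"
proof (rule ccontr)
  assume "edges_in X \<noteq> {}"
  then obtain e where "e \<in> E" "ends e \<subseteq> X"
    by (auto simp: edges_in_def)
  then have "2 \<le> card X"
    using card_mg_ends[of e] card_mono[OF assms(1)] by metis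
  then show False
    using assms(2) by simp
qed

lemma edge_count_le_nonempty:
  assumes "X \<subseteq> V" "X \<noteq> {}"
  shows "edge_count X \<le> 2 * int (card X) - 2"
proof (cases "X = V \<or> card X \<le> 1")
  case True
  have "1 \<le> card X"
    using assms by (simp add: Suc_leI card_gt_0_iff)
  then show ?thesis
    using True edge_count_V edges_in_small[of X] assms by (auto simp: edge_count_def)
next
  case False
  then have "edge_count X \<le> 2 * int (card X) - 3"
    using assms by (intro edge_count_le psubsetI) auto
  then show ?thesis
    by simp
qed

lemma edges_in_Int: "edges_in (X \<inter> Y) = edges_in X \<inter> edges_in Y"
  by (auto simp: edges_in_def)

lemma edges_in_Un: "edges_in X \<union> edges_in Y \<subseteq> edges_in (X \<union> Y)"
  by (auto simp: edges_in_def)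

lemma edge_count_card_Un: "edge_count X + edge_count Y = int (card (edges_in X \<union> edges_in Y)) + edge_count (X \<inter> Y)"
  using card_Un_Int[of "edges_in X" "edges_in Y"] by (simp add: edge_count_def edges_in_Int)

lemma edge_count_supermodular: "edge_count X + edge_count Y \<le> edge_count (X \<union> Y) + edge_count (X \<inter> Y)"
  using edge_count_card_Un[of X Y] card_mono[OF _ edges_in_Un[of X Y]] by (simp add: edge_count_def)

lemma edge_count_modular_eqD:
  assumes "edge_count (X \<union> Y) + edge_count (X \<inter> Y) \<le> edge_count X + edge_count Y"
  shows "edges_in (X \<union> Y) = edges_in X \<union> edges_in Y"
  using edge_count_card_Un[of X Y] assms edges_in_Un[of X Y]
  by (intro card_seteq[symmetric]) (simp_all add: edge_count_def)

lemma nbrs_sym: "v \<in> nbrs u \<longleftrightarrow> u \<in> nbrs v"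
  by (auto simp: nbrs_def insert_commute)

lemma nbrs_irrefl [simp]: "z \<notin> nbrs z"
  using card_mg_ends by (force simp: nbrs_def)

lemma nbrs_sub: "nbrs z \<subseteq> V"
  using mg_ends_in_verts by (auto simp: nbrs_def)

lemma finite_nbrs [simp]: "finite (nbrs z)"
  using nbrs_sub by simp

lemma edge_at:
  assumes "e \<in> E" "z \<in> ends e"
  obtains v where "ends e = {z, v}" "v \<in> nbrs z"
proof -
  obtain a b where ab: "ends e = {a, b}"
    using edge_ends[OF assms(1)] by blast
  then have "ends e = {z, if z = a then b else a}"
    using assms(2) by auto
  then show thesis
    using that assms(1) by (auto simp: nbrs_def)
qed

lemma edges_in_nbr:
  assumes "edges_in (X \<union> Y) = edges_in X \<union> edges_in Y" "u \<in> X - Y" "v \<in> Y - X"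
  shows "v \<notin> nbrs u"
proof
  assume "v \<in> nbrs u"
  then obtain e where "e \<in> E" "ends e = {u, v}"
    by (auto simp: nbrs_def)
  then have "e \<in> edges_in (X \<union> Y)"
    using assms(2,3) by (simp add: edges_in_def)
  then have "e \<in> edges_in X \<or> e \<in> edges_in Y"
    unfolding assms(1) by blast
  then show False
    using assms(2,3) \<open>ends e = {u, v}\<close> by (simp add: edges_in_def)
qed

text \<open>
  Edge counts are supermodular and the bound \<open>2 * card X - 3\<close> is modular, so both the
  union and the intersection attain the bound. Equality in the supermodular inequality moreover
  means that there is no edge between the two differences.
\<close>

lemma critical_uncross:
  assumes A: "critical A" and B: "critical B" and int: "2 \<le> card (A \<inter> B)" and un: "A \<union> B \<noteq> V"
  shows "critical (A \<inter> B)" "critical (A \<union> B)" "edges_in (A \<union> B) = edges_in A \<union> edges_in B"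
proof -
  have sub: "A \<subset> V" "B \<subset> V" "A \<union> B \<subset> V" "A \<inter> B \<subset> V"
    using A B un by (auto simp: critical_def)
  then have fin: "finite A" "finite B"
    by auto
  have "card (A \<inter> B) \<le> card (A \<union> B)"
    using fin by (intro card_mono) auto
  then have le: "edge_count (A \<union> B) \<le> 2 * int (card (A \<union> B)) - 3" "edge_count (A \<inter> B) \<le> 2 * int (card (A \<inter> B)) - 3"
    using int sub by (auto intro!: edge_count_le)
  moreover have "int (card (A \<union> B)) + int (card (A \<inter> B)) = int (card A) + int (card B)"
    using card_Un_Int[OF fin] by simp
  moreover note edge_count_supermodular[of A B]
  ultimately have "edge_count (A \<union> B) = 2 * int (card (A \<union> B)) - 3" "edge_count (A \<inter> B) = 2 * int (card (A \<inter> B)) - 3"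
    "edge_count (A \<union> B) + edge_count (A \<inter> B) \<le> edge_count A + edge_count B"
    using A B by (auto simp: critical_def)
  then show "critical (A \<inter> B)" "critical (A \<union> B)" "edges_in (A \<union> B) = edges_in A \<union> edges_in B"
    using sub int \<open>card (A \<inter> B) \<le> card (A \<union> B)\<close> edge_count_modular_eqD by (auto simp: critical_def)
qed

end

section \<open>Vertices of degree three and their blockers\<close>

lemma card_le_1_eq:
  assumes "finite S" "\<not> 2 \<le> card S" "p \<in> S"
  shows "S = {p}"
proof -
  have "card S = 1"
    using assms card_gt_0_iff[of S] by force
  then show ?thesis
    using assms(3) by (auto simp: card_1_singleton_iff)
qed

lemma card_3_other:
  assumes "card S = 3" "x \<in> S" "y \<in> S" "x \<noteq> y"
  obtains w where "S = {x, y, w}" "w \<noteq> x" "w \<noteq> y"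
proof -
  have "finite S"
    using assms(1) by (metis card.infinite zero_neq_numeral)
  then have "card (S - {x, y}) = 1"
    using assms by (simp add: card_Diff_subset)
  then obtain w where "S - {x, y} = {w}"
    by (auto simp: card_1_singleton_iff)
  then show thesis
    using assms that[of w] by blast
qed

text \<open>
  The circuit with two vertices is a pair of parallel edges; all others are simple, since two
  vertices then form a proper subset, which spans at most one edge.
\<close>

locale simple_circuit = circuit G for G :: "('v, 'e) multigraph" +
  assumes card_V3: "3 \<le> card V"
begin

lemma ends_inj: "inj_on ends E"
proof (rule inj_onI, rule ccontr)
  fix e f assume ef: "e \<in> E" "f \<in> E" "ends e = ends f" "e \<noteq> f"
  obtain u v where uv: "ends e = {u, v}" "u \<noteq> v" "u \<in> V" "v \<in> V"
    using edge_ends[OF ef(1)] by blast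
  have "{u, v} \<noteq> V"
    using uv card_V3 card_2_iff[of V] by auto
  then have "edge_count {u, v} \<le> 1"
    using edge_count_le[of "{u, v}"] uv by auto
  moreover have "{e, f} \<subseteq> edges_in {u, v}"
    using ef uv by (auto simp: edges_in_def)
  then have "2 \<le> edge_count {u, v}"
    using card_mono[of "edges_in {u, v}" "{e, f}"] ef(4) by (simp add: edge_count_def)
  ultimately show False by simp
qed

text \<open>
  In a simple graph, edge counts change by the number of neighbours. The arguments about blockers
  use only \<open>nbrs\<close> and these counts.
\<close>

lemma edge_count_insert:
  assumes "z \<notin> X"
  shows "edge_count (insert z X) = edge_count X + int (card (nbrs z \<inter> X))"
proof -
  have eq: "edges_in (insert z X) = edges_in X \<union> {e \<in> E. \<exists>v\<in>X. ends e = {z, v}}" (is "_ = _ \<union> ?S")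
  proof
    show "edges_in (insert z X) \<subseteq> edges_in X \<union> ?S"
    proof
      fix e assume e: "e \<in> edges_in (insert z X)"
      then have "e \<in> E" by (simp add: edges_in_def)
      then obtain u v where "ends e = {u, v}" "u \<noteq> v"
        using edge_ends by blast
      then show "e \<in> edges_in X \<union> ?S"
        using e by (auto simp: edges_in_def insert_commute)
    qed
  qed (auto simp: edges_in_def)
  have "ends ` ?S = (\<lambda>v. {z, v}) ` (nbrs z \<inter> X)"
    by (auto simp: nbrs_def image_iff)
  moreover have "inj_on ends ?S"
    using ends_inj by (rule inj_on_subset) auto
  moreover have "inj_on (\<lambda>v. {z, v}) (nbrs z \<inter> X)"
    by (auto simp: inj_on_def doubleton_eq_iff)
  ultimately have "card ?S = card (nbrs z \<inter> X)"
    using card_image[of ends ?S] card_image[of "\<lambda>v. {z, v}" "nbrs z \<inter> X"] by simp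
  moreover have "edges_in X \<inter> ?S = {}"
    using assms by (auto simp: edges_in_def)
  moreover have "finite ?S"
    using finite_mg_edges by simp
  ultimately show ?thesis
    by (simp add: edge_count_def eq card_Un_disjoint)
qed

lemma card_nbrs:
  assumes "z \<in> V"
  shows "3 \<le> card (nbrs z)"
proof -
  have "edge_count V = edge_count (V - {z}) + int (card (nbrs z \<inter> (V - {z})))"
    using edge_count_insert[of z "V - {z}"] assms by (simp add: insert_absorb)
  moreover have N: "nbrs z \<inter> (V - {z}) = nbrs z"
    using nbrs_sub by fastforce
  moreover have "int (card (V - {z})) = int (card V) - 1"
    using assms card_V3 by (simp add: of_nat_diff)
  moreover have "edge_count (V - {z}) \<le> 2 * int (card (V - {z})) - 3"
    using assms card_V3 by (intro edge_count_le) auto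
  ultimately show ?thesis
    using edge_count_V card_V3 unfolding N by linarith
qed

lemma sum_inner_degrees:
  assumes "Y \<subseteq> V"
  shows "(\<Sum>v\<in>Y. int (card (nbrs v \<inter> Y))) = 2 * edge_count Y"
proof -
  have "finite Y" using assms by simp
  then show ?thesis
  proof (induction Y rule: finite_induct)
    case empty
    then show ?case
      using edges_in_small[of "{}"] by (simp add: edge_count_def)
  next
    case (insert z Y)
    have "int (card (nbrs v \<inter> insert z Y)) = int (card (nbrs v \<inter> Y)) + (if v \<in> nbrs z then 1 else 0)"
      if "v \<in> Y" for v
    proof (cases "v \<in> nbrs z")
      case True
      then have "nbrs v \<inter> insert z Y = insert z (nbrs v \<inter> Y)"
        by (auto simp: nbrs_sym[of z v])
      then show ?thesis
        using True insert.hyps by simp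
    next
      case False
      then have "nbrs v \<inter> insert z Y = nbrs v \<inter> Y"
        by (auto simp: nbrs_sym[of z v])
      then show ?thesis
        using False by simp
    qed
    then have "(\<Sum>v\<in>Y. int (card (nbrs v \<inter> insert z Y)))
        = (\<Sum>v\<in>Y. int (card (nbrs v \<inter> Y))) + (\<Sum>v\<in>Y. if v \<in> nbrs z then 1 else 0)"
      by (simp add: sum.distrib)
    also have "(\<Sum>v\<in>Y. if v \<in> nbrs z then 1 else (0::int)) = int (card (nbrs z \<inter> Y))"
      using insert.hyps(1) by (simp add: sum.If_cases Int_commute)
    finally have "(\<Sum>v\<in>Y. int (card (nbrs v \<inter> insert z Y))) = 2 * edge_count Y + int (card (nbrs z \<inter> Y))"
      using insert.IH by simp
    moreover have "nbrs z \<inter> insert z Y = nbrs z \<inter> Y"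
      by auto
    ultimately show ?case
      using insert.hyps edge_count_insert[OF insert.hyps(2)] by simp
  qed
qed

lemma sum_degrees:
  assumes "Y \<subseteq> V"
  shows "(\<Sum>v\<in>Y. int (card (nbrs v))) = edge_count V - edge_count (V - Y) + edge_count Y"
proof -
  have "finite Y" using assms by simp
  then show ?thesis
    using assms
  proof (induction Y rule: finite_induct)
    case empty
    then show ?case
      using edges_in_small[of "{}"] by (simp add: edge_count_def)
  next
    case (insert z Y)
    have "V - Y = insert z (V - insert z Y)"
      using insert by auto
    then have "edge_count (V - Y) = edge_count (insert z (V - insert z Y))"
      by (rule arg_cong)
    then have "edge_count (V - Y) = edge_count (V - insert z Y) + int (card (nbrs z \<inter> (V - insert z Y)))"
      using edge_count_insert[of z "V - insert z Y"] by simp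
    moreover have "card (nbrs z) = card (nbrs z \<inter> Y) + card (nbrs z \<inter> (V - insert z Y))"
    proof -
      have "nbrs z = (nbrs z \<inter> Y) \<union> (nbrs z \<inter> (V - insert z Y))"
        using nbrs_sub by fastforce
      moreover have "(nbrs z \<inter> Y) \<inter> (nbrs z \<inter> (V - insert z Y)) = {}"
        by auto
      ultimately show ?thesis
        by (metis card_Un_disjoint finite_nbrs finite_Int)
    qed
    ultimately show ?case
      using insert edge_count_insert[OF insert.hyps(2)] by simp
  qed
qed

definition node :: "'v \<Rightarrow> bool" where
  "node z \<longleftrightarrow> z \<in> V \<and> card (nbrs z) = 3"

text \<open>
  A blocker for \<open>z\<close> and \<open>x\<close> prevents that \<open>z\<close> is replaced by
  an edge between its two other neighbours: with this edge, the critical set would have too many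
  edges. The complement of a blocker within the vertices other than \<open>z\<close> is called the
  branch of \<open>z\<close> towards \<open>x\<close>; smaller blockers have larger branches.
\<close>

definition blocker :: "'v \<Rightarrow> 'v \<Rightarrow> 'v set \<Rightarrow> bool" where
  "blocker z x A \<longleftrightarrow> critical A \<and> z \<notin> A \<and> x \<notin> A \<and> nbrs z - {x} \<subseteq> A"

definition admissible :: "'v \<Rightarrow> bool" where
  "admissible z \<longleftrightarrow> node z \<and> (\<exists>x\<in>nbrs z. \<forall>A. \<not> blocker z x A)"

text \<open>
  A critical set and a vertex with three neighbours in it span \<open>2 * k - 2\<close> edges on
  \<open>k\<close> vertices, which only the whole circuit does.
\<close>

lemma tight_V:
  assumes "critical A" "z \<in> V" "z \<notin> A" "3 \<le> card (nbrs z \<inter> A)"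
  shows "insert z A = V"
proof (rule ccontr)
  assume "insert z A \<noteq> V"
  then have "insert z A \<subset> V"
    using assms by (auto simp: critical_def)
  moreover have "card (insert z A) = card A + 1"
    using assms by (simp add: critical_def psubset_imp_subset)
  ultimately show False
    using edge_count_le[of "insert z A"] edge_count_insert[OF assms(3)] assms by (simp add: critical_def)
qed

lemma blocker_insert:
  assumes "node z" "x \<in> nbrs z" "blocker z x A"
  shows "critical (insert z A)"
proof -
  have "nbrs z \<inter> A = nbrs z - {x}"
    using assms by (auto simp: blocker_def)
  then have "card (nbrs z \<inter> A) = 2"
    using assms by (simp add: node_def)
  moreover have "card (insert z A) = card A + 1"
    using assms by (simp add: blocker_def critical_def psubset_imp_subset)
  moreover have "x \<in> V" "x \<noteq> z" "x \<notin> A" "insert z A \<subseteq> V"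
    using assms nbrs_sub[of z] nbrs_irrefl[of z] by (auto simp: blocker_def critical_def node_def)
  then have "insert z A \<subset> V"
    by blast
  ultimately show ?thesis
    using assms edge_count_insert[of z A] by (simp add: blocker_def critical_def)
qed

text \<open>
  The union of two blockers that overlap in two vertices is critical by uncrossing, and contains all
  neighbours of \<open>z\<close>.
\<close>

lemma blockers_cover_if_card:
  assumes z: "node z" and xy: "x \<in> nbrs z" "y \<in> nbrs z" "x \<noteq> y"
    and A: "blocker z x A" and B: "blocker z y B" and c: "2 \<le> card (A \<inter> B)"
  shows "A \<union> B = V - {z}" "\<And>u v. u \<in> A - B \<Longrightarrow> v \<in> B - A \<Longrightarrow> v \<notin> nbrs u"
proof -
  have *: "critical A" "critical B" "A \<union> B \<noteq> V" "z \<notin> A \<union> B" "nbrs z \<subseteq> A \<union> B" "z \<in> V"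
    using A B xy z by (auto simp: blocker_def node_def)
  note un = critical_uncross[OF *(1,2) c *(3)]
  have "nbrs z \<inter> (A \<union> B) = nbrs z"
    using * by auto
  then have "insert z (A \<union> B) = V"
    using tight_V[OF un(2) *(6,4)] z by (simp add: node_def)
  then show "A \<union> B = V - {z}"
    using * by auto
  show "\<And>u v. u \<in> A - B \<Longrightarrow> v \<in> B - A \<Longrightarrow> v \<notin> nbrs u"
    using edges_in_nbr[OF un(3)] .
qed

text \<open>
  Let \<open>P\<close>, \<open>Q\<close> cover all vertices except \<open>z\<close>, and suppose
  that \<open>Q\<close> and \<open>R\<close> share only \<open>p\<close>. If \<open>P\<close> and
  \<open>R\<close> share two vertices as well, then \<open>p\<close> is the only vertex of its
  branch, and no edge joins it to the other branches, so \<open>z\<close> is its only neighbour. If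
  they do not, then \<open>R\<close> is the single edge \<open>pq\<close>, although there is no edge
  between \<open>Q - P\<close> and \<open>P - Q\<close>.
\<close>

lemma three_blockers_cover_step:
  assumes N: "nbrs z = {p, q, r}" "p \<noteq> q" "q \<noteq> r" "p \<noteq> r" and z: "node z"
    and P: "blocker z p P" and Q: "blocker z q Q" and R: "blocker z r R"
    and c: "2 \<le> card (P \<inter> Q)"
  shows "2 \<le> card (Q \<inter> R)"
proof (rule ccontr)
  assume c': "\<not> 2 \<le> card (Q \<inter> R)"
  have fin: "finite P" "finite Q" "finite R"
    using P Q R by (auto simp: blocker_def critical_def)
  have mem: "p \<notin> P" "p \<in> Q" "p \<in> R" "q \<in> P" "q \<notin> Q" "q \<in> R" "r \<in> P" "r \<in> Q" "r \<notin> R"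
      "z \<notin> P" "z \<notin> Q" "z \<notin> R"
    using P Q R N by (auto simp: blocker_def)
  have QR: "Q \<inter> R = {p}"
    using card_le_1_eq[OF _ c', of p] fin mem by simp
  have sub: "P \<subseteq> V" "Q \<subseteq> V" "R \<subseteq> V"
    using P Q R by (auto simp: blocker_def critical_def)
  have PQ: "P \<union> Q = V - {z}" "\<And>u v. u \<in> P - Q \<Longrightarrow> v \<in> Q - P \<Longrightarrow> v \<notin> nbrs u"
    using blockers_cover_if_card[OF z _ _ N(2) P Q c] N(1) by auto
  show False
  proof (cases "2 \<le> card (P \<inter> R)")
    case True
    have PR: "P \<union> R = V - {z}" "\<And>u v. u \<in> P - R \<Longrightarrow> v \<in> R - P \<Longrightarrow> v \<notin> nbrs u"
      using blockers_cover_if_card[OF z _ _ N(4) P R True] N(1) by auto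
    have "nbrs p \<subseteq> {z}"
    proof
      fix v assume v: "v \<in> nbrs p"
      then have "v \<in> V" "v \<noteq> p"
        using nbrs_sub nbrs_irrefl by blast+
      show "v \<in> {z}"
      proof (rule ccontr)
        assume "v \<notin> {z}"
        then have "v \<in> P"
          using PQ(1) PR(1) QR \<open>v \<in> V\<close> \<open>v \<noteq> p\<close> by blast
        moreover have "v \<notin> Q \<or> v \<notin> R"
          using QR \<open>v \<noteq> p\<close> by blast
        ultimately show False
          using PQ(2)[of v p] PR(2)[of v p] mem v by (auto simp: nbrs_sym[of v p])
      qed
    qed
    then have "card (nbrs p) \<le> 1"
      using card_mono[of "{z}" "nbrs p"] by simp
    then show False
      using card_nbrs[of p] N(1) nbrs_sub[of z] by auto
  next
    case False
    have "P \<inter> R = {q}"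
      using card_le_1_eq[OF _ False, of q] fin mem by simp
    then have "R = {p, q}"
      using QR PQ(1) sub mem by auto
    then have "edge_count {p, q} = 1"
      using R N(2) by (simp add: blocker_def critical_def)
    then obtain e where "e \<in> edges_in {p, q}"
      by (fastforce simp: edge_count_def)
    then have e: "e \<in> E" "ends e \<subseteq> {p, q}"
      by (auto simp: edges_in_def)
    then have "ends e = {p, q}"
      using card_mg_ends[OF e(1)] N(2) by (metis card_2_iff card_seteq finite.emptyI finite.insertI order_refl)
    then have "p \<in> nbrs q"
      using e(1) by (auto simp: nbrs_def insert_commute)
    then show False
      using PQ(2)[of q p] mem by simp
  qed
qed

end

section \<open>Admissible vertices of 3-connected circuits\<close>

definition two_separation :: "('v, 'e) multigraph \<Rightarrow> 'v set \<Rightarrow> 'v set \<Rightarrow> bool" where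
  "two_separation G A B \<longleftrightarrow> A \<union> B = mg_verts G \<and> card (A \<inter> B) = 2 \<and> A \<noteq> mg_verts G \<and> B \<noteq> mg_verts G \<and>
     (\<forall>e\<in>mg_edges G. mg_ends G e \<subseteq> A \<or> mg_ends G e \<subseteq> B)"

lemma two_separation_commute: "two_separation G A B \<longleftrightarrow> two_separation G B A"
  by (auto simp: two_separation_def Un_commute Int_commute)

text \<open>
  Circuits without 2-separations are 3-connected: the edge counts exclude separations whose two
  sides have at most one vertex in common.
\<close>

locale three_connected_circuit = circuit G for G :: "('v, 'e) multigraph" +
  assumes card_V5: "5 \<le> card V"
    and no_two_separation: "\<not> two_separation G A B"
begin

sublocale simple_circuit
  using card_V5 by unfold_locales simp

text \<open>
  If the three blockers met pairwise in single vertices, then they would have disjoint edge sets,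
  whose total number forces them to cover all vertices and edges away from \<open>z\<close>. Each
  blocker would then be separated from the rest by two neighbours of \<open>z\<close>, so without
  2-separations it would consist of these two, and the graph would have four vertices.
\<close>

lemma three_blockers_overlap:
  assumes N: "nbrs z = {p, q, r}" "p \<noteq> q" "q \<noteq> r" "p \<noteq> r" and z: "node z"
    and P: "blocker z p P" and Q: "blocker z q Q" and R: "blocker z r R"
  shows "2 \<le> card (P \<inter> Q) \<or> 2 \<le> card (Q \<inter> R) \<or> 2 \<le> card (P \<inter> R)"
proof (rule ccontr)
  assume "\<not> ?thesis"
  then have c: "\<not> 2 \<le> card (P \<inter> Q)" "\<not> 2 \<le> card (Q \<inter> R)" "\<not> 2 \<le> card (P \<inter> R)"
    by auto
  have sub: "P \<subset> V" "Q \<subset> V" "R \<subset> V"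
    using P Q R by (auto simp: blocker_def critical_def)
  then have fin: "finite P" "finite Q" "finite R"
    by auto
  have mem: "p \<notin> P" "p \<in> Q" "p \<in> R" "q \<in> P" "q \<notin> Q" "q \<in> R" "r \<in> P" "r \<in> Q" "r \<notin> R"
      "z \<notin> P" "z \<notin> Q" "z \<notin> R"
    using P Q R N by (auto simp: blocker_def)
  have I: "P \<inter> Q = {r}" "Q \<inter> R = {p}" "P \<inter> R = {q}"
    using card_le_1_eq[OF _ c(1), of r] card_le_1_eq[OF _ c(2), of p] card_le_1_eq[OF _ c(3), of q]
      fin mem by auto
  let ?U = "P \<union> Q \<union> R"
  have cU: "card ?U + 3 = card P + card Q + card R"
  proof -
    have "(P \<union> Q) \<inter> R = {p, q}"
      using I by auto
    then show ?thesis
      using card_Un_Int[OF fin(1,2)] card_Un_Int[of "P \<union> Q" R] fin I N(2) by simp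
  qed
  have disj: "edges_in P \<inter> edges_in Q = {}" "(edges_in P \<union> edges_in Q) \<inter> edges_in R = {}"
    using I edges_in_small[of "{p}"] edges_in_small[of "{q}"] edges_in_small[of "{r}"]
    by (simp_all add: Int_Un_distrib2 flip: edges_in_Int)
  let ?F = "edges_in P \<union> edges_in Q \<union> edges_in R"
  have "card ?F = card (edges_in P) + card (edges_in Q) + card (edges_in R)"
    using disj by (simp add: card_Un_disjoint)
  then have cF: "int (card ?F) = 2 * int (card ?U) - 3"
    using P Q R cU by (simp add: blocker_def critical_def edge_count_def)
  have FU: "?F \<subseteq> edges_in ?U"
    by (auto simp: edges_in_def)
  then have ge: "int (card ?F) \<le> edge_count ?U"
    by (simp add: edge_count_def card_mono)
  have zU: "z \<notin> ?U" "z \<in> V" and NU: "nbrs z \<inter> ?U = nbrs z"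
    using mem z N(1) by (auto simp: node_def)
  have icz: "edge_count (insert z ?U) = edge_count ?U + 3"
    using edge_count_insert[OF zU(1)] NU z by (simp add: node_def)
  have cz: "card (insert z ?U) = card ?U + 1"
    using zU fin by simp
  have "card P \<le> card ?U"
    using fin by (intro card_mono) auto
  then have "2 \<le> card (insert z ?U)"
    using P cz by (simp add: blocker_def critical_def)
  moreover have "\<not> edge_count (insert z ?U) \<le> 2 * int (card (insert z ?U)) - 3"
    using icz cz cF ge by simp
  ultimately have "\<not> insert z ?U \<subset> V"
    using edge_count_le by blast
  then have UV: "insert z ?U = V"
    using sub zU(2) by blast
  then have "edge_count ?U = 2 * int (card ?U) - 3"
    using icz cz edge_count_V by simp
  then have edges: "edges_in ?U = ?F"
    using card_seteq[OF _ FU] cF by (simp add: edge_count_def)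
  have inside: "ends e \<subseteq> P \<or> ends e \<subseteq> Q \<or> ends e \<subseteq> R \<or> (\<exists>x\<in>{p, q, r}. ends e = {z, x})" if e: "e \<in> E" for e
  proof (cases "z \<in> ends e")
    case True
    then obtain x where x: "ends e = {z, x}" "x \<in> nbrs z"
      using edge_at[OF e] by blast
    from x(2) have "x \<in> {p, q, r}"
      unfolding N(1) .
    then show ?thesis
      using x(1) by blast
  next
    case False
    then have "e \<in> edges_in ?U"
      using e mg_ends_in_verts[OF e] UV by (auto simp: edges_in_def)
    then show ?thesis
      unfolding edges by (auto simp: edges_in_def)
  qed
  \<comment> \<open>Each blocker is joined to the rest of the graph only at two neighbours of \<open>z\<close>.\<close>
  have small: "X \<subseteq> {a, b}"
    if X: "X \<inter> Y = {a, b}" "a \<noteq> b" "X \<union> Y = V" "z \<in> Y" "z \<notin> X"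
      "\<And>e. e \<in> E \<Longrightarrow> ends e \<subseteq> X \<or> ends e \<subseteq> Y" for X Y a b
  proof -
    have "Y = V"
      using no_two_separation[of X Y] X zU by (auto simp: two_separation_def)
    then show ?thesis
      using X(1,3) by auto
  qed
  have "P \<subseteq> {q, r}"
  proof (rule small[of P "insert z (Q \<union> R)" q r])
    show "P \<inter> insert z (Q \<union> R) = {q, r}" "P \<union> insert z (Q \<union> R) = V"
      using I mem UV by blast+
    show "ends e \<subseteq> P \<or> ends e \<subseteq> insert z (Q \<union> R)" if "e \<in> E" for e
      using inside[OF that] mem by blast
  qed (use mem N in simp_all)
  moreover have "Q \<subseteq> {p, r}"
  proof (rule small[of Q "insert z (P \<union> R)" p r])
    show "Q \<inter> insert z (P \<union> R) = {p, r}" "Q \<union> insert z (P \<union> R) = V"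
      using I mem UV by blast+
    show "ends e \<subseteq> Q \<or> ends e \<subseteq> insert z (P \<union> R)" if "e \<in> E" for e
      using inside[OF that] mem by blast
  qed (use mem N in simp_all)
  moreover have "R \<subseteq> {p, q}"
  proof (rule small[of R "insert z (P \<union> Q)" p q])
    show "R \<inter> insert z (P \<union> Q) = {p, q}" "R \<union> insert z (P \<union> Q) = V"
      using I mem UV by blast+
    show "ends e \<subseteq> R \<or> ends e \<subseteq> insert z (P \<union> Q)" if "e \<in> E" for e
      using inside[OF that] mem by blast
  qed (use mem N in simp_all)
  ultimately have "V \<subseteq> {z, p, q, r}"
    using UV by auto
  then have "card V \<le> 4"
    using card_mono[of "{z, p, q, r}" V] by (simp add: card_insert_if split: if_splits)
  then show False
    using card_V5 by simp
qed

text \<open>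
  One overlap in two vertices exists and spreads to all pairs of blockers of an inadmissible vertex.
  In terms of complements, its branches towards different neighbours are disjoint and nonadjacent.
\<close>

lemma blockers_cover:
  assumes z: "node z" "\<not> admissible z" and xy: "x \<in> nbrs z" "y \<in> nbrs z" "x \<noteq> y"
    and A: "blocker z x A" and B: "blocker z y B"
  shows "A \<union> B = V - {z}" "\<And>u v. u \<in> A - B \<Longrightarrow> v \<in> B - A \<Longrightarrow> v \<notin> nbrs u"
proof -
  obtain w where w: "nbrs z = {x, y, w}" "w \<noteq> x" "w \<noteq> y"
    using card_3_other[of "nbrs z" x y] z xy by (auto simp: node_def)
  then obtain C where C: "blocker z w C"
    using z by (auto simp: admissible_def)
  have "2 \<le> card (A \<inter> B)"
  proof -
    consider "2 \<le> card (A \<inter> B)" | "2 \<le> card (B \<inter> C)" | "2 \<le> card (A \<inter> C)"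
      using three_blockers_overlap[OF w(1) xy(3) w(3)[symmetric] w(2)[symmetric] z(1) A B C] by blast
    then show ?thesis
    proof cases
      case 2
      have "nbrs z = {w, y, x}" using w by auto
      from three_blockers_cover_step[OF this w(3) xy(3)[symmetric] w(2) z(1) C B A] 2
      show ?thesis by (simp add: Int_commute)
    next
      case 3
      have "nbrs z = {w, x, y}" using w by auto
      from three_blockers_cover_step[OF this w(2) xy(3) w(3) z(1) C A B] 3
      show ?thesis by (simp add: Int_commute)
    qed
  qed
  from blockers_cover_if_card[OF z(1) xy A B this]
  show "A \<union> B = V - {z}" "\<And>u v. u \<in> A - B \<Longrightarrow> v \<in> B - A \<Longrightarrow> v \<notin> nbrs u"
    by blast+
qed

lemma minimal_blocker:
  assumes "blocker z x A"
  obtains B where "blocker z x B" "\<And>B'. B' \<subset> B \<Longrightarrow> \<not> blocker z x B'"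
proof -
  obtain B where B: "blocker z x B" "\<And>B'. blocker z x B' \<Longrightarrow> card B \<le> card B'"
    using ex_has_least_nat[of "blocker z x" A card] assms by blast
  have "finite B"
    using B(1) by (auto simp: blocker_def critical_def)
  then have "\<not> blocker z x B'" if "B' \<subset> B" for B'
    using B(2)[of B'] psubset_card_mono[OF _ that] by auto
  then show thesis
    using B(1) that by blast
qed

lemma sum_degrees_critical:
  assumes "critical X"
  shows "(\<Sum>v\<in>V - X. int (card (nbrs v))) = 2 * int (card (V - X)) + 1 + edge_count (V - X)"
proof -
  have X: "X \<subseteq> V" "edge_count X = 2 * int (card X) - 3"
    using assms by (auto simp: critical_def)
  moreover have "int (card (V - X)) = int (card V) - int (card X)"
    using X(1) by (simp add: card_Diff_subset of_nat_diff card_mono)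
  moreover have "V - (V - X) = X"
    using X(1) by auto
  ultimately show ?thesis
    using sum_degrees[of "V - X"] edge_count_V by simp
qed

text \<open>
  Let \<open>C\<close> be the branch, with \<open>k\<close> vertices, all of degree 3. It spans
  \<open>k - 1\<close> edges and one more leads to \<open>z\<close>, so some \<open>u\<close> in
  \<open>C\<close> has at most one neighbour in \<open>C\<close> or \<open>z\<close>. Hence the
  blocker \<open>A\<close> of \<open>z\<close> is also a blocker of \<open>u\<close>. If
  \<open>u\<close> were inadmissible, let \<open>B\<close> be its blocker for a neighbour
  \<open>p\<close> in \<open>A\<close>. Since \<open>z\<close> is in \<open>B\<close> but not in
  \<open>A\<close>, its neighbours other than \<open>x\<close> are not in \<open>A - B\<close>. So
  \<open>A \<inter> B\<close> is a blocker of \<open>z\<close> that lacks \<open>p\<close>, which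
  contradicts the minimality of \<open>A\<close>.
\<close>

lemma admissible_in_node_branch:
  assumes z: "node z" and x: "x \<in> nbrs z" and A: "blocker z x A"
    and min: "\<And>A'. A' \<subset> A \<Longrightarrow> \<not> blocker z x A'"
    and nodes: "\<And>v. v \<in> V - insert z A \<Longrightarrow> node v"
  shows "\<exists>u\<in>V - insert z A. admissible u"
proof -
  define C where "C = V - insert z A"
  have zV: "z \<in> V" and Acrit: "critical A" and A_sub: "A \<subseteq> V" and zA: "z \<notin> A" and xA: "x \<notin> A"
    and NA: "nbrs z - {x} \<subseteq> A"
    using z A by (auto simp: node_def blocker_def critical_def)
  have C: "finite C" "C \<subseteq> V" "z \<notin> C"
    by (auto simp: C_def)
  have split: "V = insert z C \<union> A" "insert z C \<inter> A = {}"
    using zV A_sub zA by (auto simp: C_def)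
  have NzC: "nbrs z \<inter> C = {x}"
  proof -
    have "x \<in> V" "x \<noteq> z"
      using x nbrs_sub nbrs_irrefl by blast+
    then show ?thesis
      using NA xA x by (auto simp: C_def)
  qed
  have icC: "edge_count C = int (card C) - 1"
  proof -
    have "(\<Sum>v\<in>C. int (card (nbrs v))) = 3 * int (card C)"
      using nodes by (simp add: C_def node_def)
    then show ?thesis
      using sum_degrees_critical[OF blocker_insert[OF z x A]] by (simp add: C_def)
  qed
  have "(\<Sum>u\<in>C. int (card (nbrs u \<inter> insert z C))) = 2 * int (card C) - 1"
  proof -
    have "nbrs z \<inter> insert z C = {x}"
      using NzC by auto
    then show ?thesis
      using sum_inner_degrees[of "insert z C"] edge_count_insert[OF C(3)] C zV NzC icC by simp
  qed
  moreover have "2 * int (card C) \<le> (\<Sum>u\<in>C. int (card (nbrs u \<inter> insert z C)))"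
    if "\<And>u. u \<in> C \<Longrightarrow> 2 \<le> card (nbrs u \<inter> insert z C)"
    using sum_mono[of C "\<lambda>_. 2" "\<lambda>u. int (card (nbrs u \<inter> insert z C))"] that by fastforce
  ultimately obtain u where u: "u \<in> C" "\<not> 2 \<le> card (nbrs u \<inter> insert z C)"
    by fastforce
  have uz: "u \<noteq> z" "u \<in> V" "u \<notin> A"
    using u(1) by (auto simp: C_def)
  have cN: "card (nbrs u) = card (nbrs u \<inter> insert z C) + card (nbrs u \<inter> A)"
  proof -
    have "nbrs u = (nbrs u \<inter> insert z C) \<union> (nbrs u \<inter> A)"
      using nbrs_sub[of u] split(1) by blast
    moreover have "(nbrs u \<inter> insert z C) \<inter> (nbrs u \<inter> A) = {}"
      using split(2) by blast
    ultimately show ?thesis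
      by (metis card_Un_disjoint finite_Int finite_nbrs)
  qed
  have "insert u A \<noteq> V"
    using uz zV zA by (metis insert_iff)
  then have "\<not> 3 \<le> card (nbrs u \<inter> A)"
    using tight_V[OF Acrit uz(2,3)] by blast
  then have "card (nbrs u \<inter> insert z C) = 1" "card (nbrs u \<inter> A) = 2"
    using cN u nodes[of u] by (auto simp: node_def C_def)
  then obtain u1 where u1: "nbrs u \<inter> insert z C = {u1}" and "nbrs u \<inter> A \<noteq> {}"
    by (metis card.empty card_1_singletonE zero_neq_numeral)
  then obtain p where p: "p \<in> nbrs u" "p \<in> A"
    by auto
  have u1': "u1 \<in> nbrs u" "u1 \<notin> A"
    using u1 split(2) by auto
  have Au: "blocker u u1 A"
    using Acrit uz u1 u1' nbrs_sub[of u] split(1) by (auto simp: blocker_def)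
  have "admissible u"
  proof (rule ccontr)
    assume nadm: "\<not> admissible u"
    have nu: "node u"
      using nodes u(1) by (simp add: C_def)
    obtain B where B: "blocker u p B"
      using nadm nu p by (auto simp: admissible_def)
    have "u1 \<noteq> p"
      using p u1' by auto
    note cov = blockers_cover[OF nu nadm u1'(1) p(1) this Au B]
    have zB: "z \<in> B - A"
      using cov(1) zV zA uz by auto
    have NB: "nbrs z - {x} \<subseteq> A \<inter> B"
    proof
      fix y assume y: "y \<in> nbrs z - {x}"
      then have "z \<in> nbrs y"
        by (simp add: nbrs_sym[of z y])
      then show "y \<in> A \<inter> B"
        using cov(2)[OF _ zB, of y] y NA by blast
    qed
    have "card (nbrs z - {x}) = 2"
      using z x by (simp add: node_def)
    then have "2 \<le> card (A \<inter> B)"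
      using card_mono[OF _ NB] A_sub by simp
    moreover have "A \<union> B \<noteq> V"
      using cov(1) uz(2) by auto
    ultimately have "critical (A \<inter> B)"
      using critical_uncross(1)[of A B] Au B by (simp add: blocker_def)
    then have "blocker z x (A \<inter> B)"
      using NB zA xA by (simp add: blocker_def)
    moreover have "A \<inter> B \<subset> A"
      using p B by (auto simp: blocker_def)
    ultimately show False
      using min by blast
  qed
  then show ?thesis
    using u(1) by (auto simp: C_def)
qed

text \<open>
  The degree sum over the complement is too small for the vertices of degree 3 to be nonadjacent to
  the others: such a set of \<open>k\<close> vertices of degree 3 spans at most \<open>k\<close>
  edges, while the remaining \<open>m\<close> vertices have degree at least 4 and span at most
  \<open>2 * m - 2\<close> edges.
\<close>

lemma node_next_to_non_node:
  assumes X: "critical X" and ex: "v \<in> V - X" "\<not> node v"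
  obtains u u1 where "u \<in> V - X" "node u" "u1 \<in> V - X" "\<not> node u1" "u1 \<in> nbrs u"
proof (rule ccontr)
  assume "\<not> thesis"
  then have none: "\<And>a b. a \<in> V - X \<Longrightarrow> node a \<Longrightarrow> b \<in> V - X \<Longrightarrow> \<not> node b \<Longrightarrow> b \<notin> nbrs a"
    using that by blast
  define N where "N = {a \<in> V - X. node a}"
  define M where "M = {a \<in> V - X. \<not> node a}"
  have NM: "V - X = N \<union> M" "N \<inter> M = {}" "finite N" "finite M" "N \<subseteq> V" "M \<subseteq> V" "M \<noteq> {}"
    using ex by (auto simp: N_def M_def)
  then have cNM: "int (card (V - X)) = int (card N) + int (card M)"
    by (simp add: card_Un_disjoint)
  have "edges_in (V - X) \<subseteq> edges_in N \<union> edges_in M"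
  proof
    fix e assume e: "e \<in> edges_in (V - X)"
    then have eE: "e \<in> E" by (simp add: edges_in_def)
    obtain a b where ab: "ends e = {a, b}"
      using edge_ends[OF eE] by blast
    then have "b \<in> nbrs a" "a \<in> nbrs b"
      using eE by (auto simp: nbrs_def insert_commute)
    then show "e \<in> edges_in N \<union> edges_in M"
      using e ab none[of a b] none[of b a] by (auto simp: edges_in_def N_def M_def)
  qed
  then have "card (edges_in (V - X)) \<le> card (edges_in N \<union> edges_in M)"
    by (simp add: card_mono)
  also have "\<dots> \<le> card (edges_in N) + card (edges_in M)"
    by (rule card_Un_le)
  finally have icC: "edge_count (V - X) \<le> edge_count N + edge_count M"
    by (simp add: edge_count_def)
  have sN: "(\<Sum>a\<in>N. int (card (nbrs a))) = 3 * int (card N)"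
    by (simp add: N_def node_def)
  have "4 \<le> int (card (nbrs a))" if "a \<in> M" for a
    using card_nbrs[of a] that by (auto simp: M_def node_def)
  then have sM: "4 * int (card M) \<le> (\<Sum>a\<in>M. int (card (nbrs a)))"
    using sum_mono[of M "\<lambda>_. 4" "\<lambda>a. int (card (nbrs a))"] by simp
  have icM: "edge_count M \<le> 2 * int (card M) - 2"
    using edge_count_le_nonempty NM by blast
  have icN: "edge_count N \<le> int (card N)"
  proof -
    have "V - N \<noteq> {}"
      using NM by blast
    then have "edge_count (V - N) \<le> 2 * int (card (V - N)) - 2"
      by (intro edge_count_le_nonempty) auto
    moreover have "int (card (V - N)) = int (card V) - int (card N)"
      using NM by (simp add: card_Diff_subset of_nat_diff card_mono)
    ultimately show ?thesis
      using sum_degrees[OF NM(5)] sN edge_count_V by simp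
  qed
  have "(\<Sum>a\<in>V - X. int (card (nbrs a))) = (\<Sum>a\<in>N. int (card (nbrs a))) + (\<Sum>a\<in>M. int (card (nbrs a)))"
    using NM by (simp add: sum.union_disjoint)
  then show False
    using sum_degrees_critical[OF X] icC sN sM icM icN cNM by simp
qed

text \<open>
  Let \<open>u\<close> be a vertex of degree 3 in the complement that is next to a vertex
  \<open>u1\<close> of larger degree. If \<open>u\<close> is inadmissible, then uncrossing
  \<open>X\<close> with its blocker for \<open>u1\<close> gives a larger critical set whose
  complement still contains \<open>u1\<close>, and induction applies. This fails only if the blocker
  meets \<open>X\<close> in at most one vertex; then another branch of \<open>u\<close> is disjoint
  from \<open>X\<close>. If that branch consists of vertices of degree 3, then
  \<open>admissible_in_node_branch\<close> applies to it, and otherwise induction does.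
\<close>

lemma admissible_in_complement:
  assumes "critical X" "v \<in> V - X" "\<not> node v"
  shows "\<exists>u\<in>V - X. admissible u"
  using assms
proof (induction "card (V - X)" arbitrary: X v rule: less_induct)
  case less
  have IH: "\<exists>u\<in>V - Y. admissible u" if "V - Y \<subset> V - X" "critical Y" "a \<in> V - Y" "\<not> node a" for Y a
    using less.hyps[of Y a] psubset_card_mono[OF _ that(1)] that by simp
  obtain u u1 where u: "u \<in> V - X" "node u" and u1: "u1 \<in> V - X" "\<not> node u1" "u1 \<in> nbrs u"
    using node_next_to_non_node[OF less.prems] by blast
  show ?case
  proof (cases "admissible u")
    case False
    have ex: "\<exists>B. blocker u a B" if "a \<in> nbrs u" for a
      using False u(2) that by (auto simp: admissible_def)
    obtain B1 where B1: "blocker u u1 B1"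
      using ex[OF u1(3)] by blast
    show ?thesis
    proof (cases "2 \<le> card (X \<inter> B1)")
      case True
      have "X \<union> B1 \<noteq> V"
        using u(1) B1 by (auto simp: blocker_def)
      then have "critical (X \<union> B1)"
        using critical_uncross(2)[OF less.prems(1) _ True] B1 by (simp add: blocker_def)
      then have "blocker u u1 (X \<union> B1)"
        using B1 u1 u by (auto simp: blocker_def)
      then have "critical (insert u (X \<union> B1))"
        by (rule blocker_insert[OF u(2) u1(3)])
      moreover have "u1 \<in> V - insert u (X \<union> B1)"
        using u1 u(2) B1 nbrs_irrefl by (auto simp: blocker_def)
      moreover have "V - insert u (X \<union> B1) \<subset> V - X"
        using u(1) by auto
      ultimately have "\<exists>a\<in>V - insert u (X \<union> B1). admissible a"
        using IH u1(2) by blast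
      then show ?thesis by auto
    next
      case small: False
      \<comment> \<open>Now \<open>X\<close> lies almost completely in the branch of \<open>u1\<close>, and another branch avoids it.\<close>
      obtain r where r: "r \<in> nbrs u" "r \<noteq> u1"
      proof -
        have "card {u1} < card (nbrs u)"
          using u(2) by (simp add: node_def)
        then have "\<not> nbrs u \<subseteq> {u1}"
          using card_mono[of "{u1}" "nbrs u"] by auto
        then show thesis
          using that by blast
      qed
      obtain q where q: "nbrs u = {u1, r, q}" "q \<noteq> u1" "q \<noteq> r"
        using card_3_other[of "nbrs u" u1 r] u(2) u1(3) r by (auto simp: node_def)
      obtain B2 where B2: "blocker u r B2" "\<And>B'. B' \<subset> B2 \<Longrightarrow> \<not> blocker u r B'"
        using ex[OF r(1)] minimal_blocker by metis
      have qN: "q \<in> nbrs u" using q by simp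
      obtain B3 where B3: "blocker u q B3" "\<And>B'. B' \<subset> B3 \<Longrightarrow> \<not> blocker u q B'"
        using ex[OF qN] minimal_blocker by metis
      have cov: "B1 \<union> B2 = V - {u}" "B1 \<union> B3 = V - {u}" "B2 \<union> B3 = V - {u}"
        using blockers_cover(1)[OF u(2) False u1(3) r(1) _ B1 B2(1)]
          blockers_cover(1)[OF u(2) False u1(3) qN _ B1 B3(1)]
          blockers_cover(1)[OF u(2) False r(1) qN _ B2(1) B3(1)] r q by auto
      have "X \<subseteq> V"
        using less.prems(1) by (auto simp: critical_def)
      have "(V - insert u B2) \<inter> X = {} \<or> (V - insert u B3) \<inter> X = {}"
      proof (rule ccontr)
        assume "\<not> ?thesis"
        then obtain a b where ab: "a \<in> V - insert u B2" "a \<in> X" "b \<in> V - insert u B3" "b \<in> X"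
          by blast
        then have "{a, b} \<subseteq> X \<inter> B1" "a \<noteq> b"
          using cov by blast+
        moreover have "finite (X \<inter> B1)"
          using \<open>X \<subseteq> V\<close> by simp
        ultimately have "card {a, b} \<le> card (X \<inter> B1)" "card {a, b} = 2"
          by (simp_all only: card_mono card_2_iff) blast
        then show False
          using small by simp
      qed
      then obtain c B where c: "c \<in> nbrs u" and B: "blocker u c B" "\<And>B'. B' \<subset> B \<Longrightarrow> \<not> blocker u c B'"
        and disj: "(V - insert u B) \<inter> X = {}"
        using B2 B3 r(1) qN by blast
      have sub: "V - insert u B \<subset> V - X"
        using disj u(1) by auto
      have "\<exists>a\<in>V - insert u B. admissible a"
      proof (cases "\<forall>a\<in>V - insert u B. node a")
        case True
        then show ?thesis
          using admissible_in_node_branch[OF u(2) c B] by blast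
      next
        case f: False
        then show ?thesis
          using IH[OF sub blocker_insert[OF u(2) c B(1)]] by blast
      qed
      then show ?thesis
        using sub by blast
    qed
  qed (use u in blast)
qed

lemma admissible_in_minimal_branch:
  assumes z: "node z" and x: "x \<in> nbrs z" and A: "blocker z x A"
    and min: "\<And>A'. A' \<subset> A \<Longrightarrow> \<not> blocker z x A'"
  shows "\<exists>u\<in>V - insert z A. admissible u"
  using admissible_in_node_branch[OF assms] admissible_in_complement[OF blocker_insert[OF z x A]]
  by blast

text \<open>
  If all vertices of degree 3 are admissible, there are at least four of them by the degree sum.
  Otherwise the branches of an inadmissible one supply three pairwise nonadjacent admissible
  vertices, which cannot be \<open>s\<close>, \<open>t\<close> and \<open>w\<close> because
  \<open>s\<close> and \<open>w\<close> are adjacent.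
\<close>

lemma exists_admissible:
  assumes "w \<in> nbrs s"
  obtains z where "admissible z" "z \<notin> {s, t, w}"
proof (cases "\<forall>z. node z \<longrightarrow> admissible z")
  case True
  define N where "N = {z \<in> V. node z}"
  have N: "N \<subseteq> V" "finite N"
    by (auto simp: N_def)
  have "4 - (if v \<in> N then 1 else 0) \<le> int (card (nbrs v))" if "v \<in> V" for v
    using card_nbrs[OF that] that by (auto simp: N_def node_def)
  then have "(\<Sum>v\<in>V. 4 - (if v \<in> N then 1 else 0)) \<le> (\<Sum>v\<in>V. int (card (nbrs v)))"
    by (intro sum_mono) auto
  moreover have "(\<Sum>v\<in>V. 4 - (if v \<in> N then 1 else (0::int))) = 4 * int (card V) - int (card N)"
    using N by (simp add: sum_subtractf sum.If_cases Int_absorb1)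
  moreover have "(\<Sum>v\<in>V. int (card (nbrs v))) = 4 * int (card V) - 4"
    using sum_inner_degrees[of V] nbrs_sub edge_count_V by (simp add: Int_absorb2)
  ultimately have "4 \<le> card N"
    by linarith
  moreover have "card {s, t, w} \<le> 3"
    by (simp add: card_insert_if)
  ultimately have "\<not> N \<subseteq> {s, t, w}"
    using card_mono[of "{s, t, w}" N] by auto
  then show thesis
    using that True by (auto simp: N_def)
next
  case False
  then obtain z where z: "node z" "\<not> admissible z"
    by blast
  have branch: "\<exists>A u. blocker z x A \<and> u \<in> V - insert z A \<and> admissible u" if "x \<in> nbrs z" for x
    using z that minimal_blocker admissible_in_minimal_branch[OF z(1) that] unfolding admissible_def by metis
  have far: "u \<noteq> v \<and> v \<notin> nbrs u"
    if "x \<in> nbrs z" "y \<in> nbrs z" "x \<noteq> y" "blocker z x A" "u \<in> V - insert z A"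
      "blocker z y B" "v \<in> V - insert z B" for x y A B u v
    using blockers_cover[OF z that(1,2,3,4,6)] that(5,7) nbrs_sym[of u v] by blast
  obtain a b c where abc: "nbrs z = {a, b, c}" "a \<noteq> b" "b \<noteq> c" "a \<noteq> c"
    using z(1) by (auto simp: node_def card_3_iff)
  obtain A u where A: "blocker z a A" "u \<in> V - insert z A" "admissible u"
    using branch[of a] abc by auto
  obtain B v where B: "blocker z b B" "v \<in> V - insert z B" "admissible v"
    using branch[of b] abc by auto
  obtain C x where C: "blocker z c C" "x \<in> V - insert z C" "admissible x"
    using branch[of c] abc by auto
  have d: "u \<noteq> v \<and> v \<notin> nbrs u" "v \<noteq> x \<and> x \<notin> nbrs v" "u \<noteq> x \<and> x \<notin> nbrs u"
    using far[OF _ _ abc(2) A(1,2) B(1,2)] far[OF _ _ abc(3) B(1,2) C(1,2)]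
      far[OF _ _ abc(4) A(1,2) C(1,2)] abc(1) by auto
  have "\<not> {u, v, x} \<subseteq> {s, t, w}"
  proof
    assume sub: "{u, v, x} \<subseteq> {s, t, w}"
    have "card {s, t, w} \<le> card {u, v, x}"
      using d by (simp add: card_insert_if)
    then have "{s, t, w} = {u, v, x}"
      using sub card_seteq[OF _ sub] by simp
    then have "s \<in> {u, v, x}" "w \<in> {u, v, x}"
      by blast+
    then show False
      using assms d nbrs_sym nbrs_irrefl by blast
  qed
  then show thesis
    using that A(3) B(3) C(3) by blast
qed

end

section \<open>Splitting off a vertex of degree three\<close>

text \<open>
  The edge \<open>e1\<close> of \<open>T\<close> with upper end \<open>b\<close> is removed, and
  \<open>z\<close> is inserted above \<open>c\<close> and below \<open>d\<close> and
  \<open>b\<close>. Then \<open>cz\<close> is the entering edge of \<open>z\<close>,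
  \<open>zb\<close> replaces \<open>e1\<close> as the entering edge of \<open>b\<close>, and
  \<open>zd\<close> is the leaving edge of \<open>z\<close>. The lower end of \<open>e1\<close>
  loses nothing, since an edge of \<open>T\<close> only serves its upper end.
\<close>

lemma insert_vertex:
  fixes pos :: "'v \<Rightarrow> real"
  assumes fin: "finite (mg_verts G)" and z: "z \<in> mg_verts G" "z \<noteq> s" "z \<noteq> t"
    and G': "mg_verts G' = mg_verts G - {z}" "mg_edges G' = insert e1 E0" "e1 \<notin> E0"
    and G: "mg_edges G = E0 \<union> {ec, ed, eb}" "ec \<noteq> ed" "ec \<noteq> eb" "ed \<noteq> eb" "{ec, ed, eb} \<inter> E0 = {}"
    and ends: "\<And>e. e \<in> E0 \<Longrightarrow> mg_ends G e = mg_ends G' e"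
      "\<And>e. e \<in> E0 \<Longrightarrow> z \<notin> mg_ends G e"
      "mg_ends G ec = {z, c}" "mg_ends G ed = {z, d}" "mg_ends G eb = {z, b}"
    and sys: "branching_system G' s t T lo hi pos" and e1: "e1 \<in> T" "hi e1 = b"
    and cdb: "z \<notin> {c, d, b}" and less: "pos c < pos d" "pos c < pos b"
  shows "\<exists>T' lo' hi' pos'. branching_system G s t T' lo' hi' pos' \<and> (\<forall>f\<in>E0. f \<in> T' \<longleftrightarrow> f \<in> T)"
proof -
  note sys = system_edges[OF sys]
  have "\<not> {pos c<..<min (pos d) (pos b)} \<subseteq> pos ` mg_verts G"
    using less fin finite_subset[of "{pos c<..<min (pos d) (pos b)}" "pos ` mg_verts G"]
      infinite_Ioo[of "pos c" "min (pos d) (pos b)"] by auto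
  then obtain m where "m \<in> {pos c<..<min (pos d) (pos b)}" "m \<notin> pos ` mg_verts G"
    by blast
  then have m: "pos c < m" "m < pos d" "m < pos b" "m \<notin> pos ` mg_verts G"
    by simp_all
  define T' where "T' = (T - {e1}) \<union> {ec, eb}"
  define lo' where "lo' = lo(ec := c, eb := z, ed := z)"
  define hi' where "hi' = hi(ec := z, eb := b, ed := d)"
  define pos' where "pos' = pos(z := m)"
  have E0: "lo' e = lo e" "hi' e = hi e" if "e \<in> E0" for e
    using that G by (auto simp: lo'_def hi'_def)
  have T0: "T - {e1} \<subseteq> E0"
    using sys(1) G' by auto
  have b: "b \<in> mg_verts G - {z} - {s}"
    using sys(5) e1 G' by (auto simp: bij_betw_def)
  have "T' \<subseteq> mg_edges G"
    using T0 G by (auto simp: T'_def)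
  moreover have "inj_on pos' (mg_verts G)"
    using sys(2) m(4) by (auto simp: pos'_def G' inj_on_def)
  moreover have "mg_ends G e = {lo' e, hi' e} \<and> pos' (lo' e) < pos' (hi' e)" if e: "e \<in> mg_edges G" for e
  proof (cases "e \<in> E0")
    case True
    then show ?thesis
      using sys(3,4)[of e] ends(1,2)[OF True] E0[OF True] G' by (auto simp: pos'_def)
  next
    case False
    then show ?thesis
      using e G ends(3-5) m cdb by (auto simp: lo'_def hi'_def pos'_def)
  qed
  moreover have "bij_betw hi' T' (mg_verts G - {s})"
  proof -
    have "bij_betw hi (T - {e1}) ((mg_verts G - {z} - {s}) - {b})"
      using bij_betw_DiffI[OF sys(5) bij_betw_singletons[of hi e1]] e1 b G' by simp
    then have "bij_betw hi' (T - {e1}) ((mg_verts G - {z} - {s}) - {b})"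
      using E0(2) T0 by (subst bij_betw_cong[of _ hi' hi]) auto
    moreover have "bij_betw hi' {ec, eb} {z, b}"
      using G cdb by (auto simp: hi'_def bij_betw_def)
    ultimately have "bij_betw hi' T' (((mg_verts G - {z} - {s}) - {b}) \<union> {z, b})"
      unfolding T'_def by (rule bij_betw_combine) auto
    moreover have "((mg_verts G - {z} - {s}) - {b}) \<union> {z, b} = mg_verts G - {s}"
      using z b by auto
    ultimately show ?thesis by simp
  qed
  moreover have "bij_betw lo' (mg_edges G - T') (mg_verts G - {t})"
  proof -
    have "mg_edges G' - T = E0 - T"
      using G' e1 by auto
    then have "bij_betw lo (E0 - T) (mg_verts G - {z} - {t})"
      using sys(6) G' by simp
    then have "bij_betw lo' (E0 - T) (mg_verts G - {z} - {t})"
      using E0(1) by (subst bij_betw_cong[of _ lo' lo]) auto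
    moreover have "bij_betw lo' {ed} {z}"
      using G by (simp add: lo'_def bij_betw_def)
    ultimately have "bij_betw lo' ((E0 - T) \<union> {ed}) ((mg_verts G - {z} - {t}) \<union> {z})"
      by (rule bij_betw_combine) auto
    moreover have "(E0 - T) \<union> {ed} = mg_edges G - T'"
      using G G' T0 by (auto simp: T'_def)
    moreover have "(mg_verts G - {z} - {t}) \<union> {z} = mg_verts G - {t}"
      using z by auto
    ultimately show ?thesis by simp
  qed
  ultimately have "branching_system G s t T' lo' hi' pos'"
    by (simp add: branching_system_def)
  moreover have "\<forall>f\<in>E0. f \<in> T' \<longleftrightarrow> f \<in> T"
    using G G' by (auto simp: T'_def)
  ultimately show ?thesis by blast
qed

text \<open>
  By reversal, let \<open>e1\<close> belong to \<open>T\<close>, with lower end \<open>a\<close>.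
  The lower one of \<open>a\<close> and \<open>w\<close> takes the role of \<open>c\<close> in
  \<open>insert_vertex\<close>, and the other one that of \<open>d\<close>.
\<close>

lemma insert_vertex_on_edge:
  fixes pos :: "'v \<Rightarrow> real"
  assumes fin: "finite (mg_verts G)" and z: "z \<in> mg_verts G" "z \<noteq> s" "z \<noteq> t"
    and G': "mg_verts G' = mg_verts G - {z}" "mg_edges G' = insert e1 E0" "e1 \<notin> E0"
    and G: "mg_edges G = E0 \<union> {ex, ey, ew}" "distinct [ex, ey, ew]" "{ex, ey, ew} \<inter> E0 = {}"
    and ends: "\<And>e. e \<in> E0 \<Longrightarrow> mg_ends G e = mg_ends G' e"
      "\<And>e. e \<in> E0 \<Longrightarrow> z \<notin> mg_ends G e" "mg_ends G' e1 = {x, y}"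
      "mg_ends G ex = {z, x}" "mg_ends G ey = {z, y}" "mg_ends G ew = {z, w}"
    and xyw: "distinct [x, y, w]" "z \<notin> {x, y, w}" "{x, y, w} \<subseteq> mg_verts G"
    and sys: "branching_system G' s t T lo hi pos"
  shows "\<exists>T' lo' hi' pos'. branching_system G s t T' lo' hi' pos' \<and> (\<forall>f\<in>E0. f \<in> T' \<longleftrightarrow> f \<in> T)"
proof -
  have main: "\<exists>T' lo' hi' pos'. branching_system G s t T' lo' hi' pos' \<and> (\<forall>f\<in>E0. f \<in> T' \<longleftrightarrow> f \<in> T)"
    if st: "z \<noteq> s" "z \<noteq> t" and sys: "branching_system G' s t T lo hi pos" and e1: "e1 \<in> T"
    for s t T lo hi and pos :: "'v \<Rightarrow> real"
  proof -
    have half: ?thesis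
      if ab: "lo e1 = a" "hi e1 = b" and eab: "{ea, eb} = {ex, ey}" "ea \<noteq> eb"
        and endab: "mg_ends G ea = {z, a}" "mg_ends G eb = {z, b}" and aw: "a \<noteq> w" "{a, b} = {x, y}"
      for a b ea eb
    proof -
      have "e1 \<in> mg_edges G'"
        using G' by simp
      then have pab: "pos a < pos b"
        using system_edges(4)[OF sys] ab by auto
      have E: "mg_edges G = E0 \<union> {ea, ew, eb}" "mg_edges G = E0 \<union> {ew, ea, eb}"
        using G(1) eab by auto
      have neq: "ea \<noteq> ew" "ea \<noteq> eb" "ew \<noteq> eb" "{ea, ew, eb} \<inter> E0 = {}" "{ew, ea, eb} \<inter> E0 = {}"
        using G(2,3) eab by auto
      have zab: "z \<notin> {a, w, b}" "z \<notin> {w, a, b}"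
        using xyw aw by auto
      have "a \<in> {x, y}"
        using aw(2) by blast
      then have "a \<in> mg_verts G'" "w \<in> mg_verts G'"
        using xyw(2,3) G'(1) by auto
      then have "pos a \<noteq> pos w"
        using inj_onD[OF system_edges(2)[OF sys]] aw(1) by blast
      then consider "pos a < pos w" | "pos w < pos a" by linarith
      then show ?thesis
      proof cases
        case 1
        show ?thesis
          by (rule insert_vertex[OF fin z(1) st G' E(1) neq(1,2,3,4) ends(1,2) endab(1) ends(6) endab(2)
                sys e1 ab(2) zab(1) 1 pab])
      next
        case 2
        show ?thesis
          by (rule insert_vertex[OF fin z(1) st G' E(2) neq(1)[symmetric] neq(3,2,5) ends(1,2) ends(6) endab
                sys e1 ab(2) zab(2) 2 less_trans[OF 2 pab]])
      qed
    qed
    have "{lo e1, hi e1} = {x, y}"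
      using system_edges(3)[OF sys, of e1] G' ends(3) by simp
    then consider "lo e1 = x" "hi e1 = y" | "lo e1 = y" "hi e1 = x"
      by (auto simp: doubleton_eq_iff)
    then show ?thesis
    proof cases
      case 1
      show ?thesis
        by (rule half[OF 1 refl _ ends(4,5)]) (use G xyw in auto)
    next
      case 2
      show ?thesis
        by (rule half[OF 2 _ _ ends(5,4)]) (use G xyw in auto)
    qed
  qed
  show ?thesis
  proof (cases "e1 \<in> T")
    case True
    then show ?thesis
      using main[OF z(2,3) sys] by blast
  next
    case False
    then have "e1 \<in> mg_edges G' - T"
      using G' by simp
    from main[OF z(3,2) branching_system_reverse[OF sys] this]
    obtain T' lo' hi' and pos' :: "'v \<Rightarrow> real" where T': "branching_system G t s T' lo' hi' pos'"
      "\<forall>f\<in>E0. f \<in> T' \<longleftrightarrow> f \<in> mg_edges G' - T"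
      by blast
    have "\<forall>f\<in>E0. f \<in> mg_edges G - T' \<longleftrightarrow> f \<in> T"
      using T'(2) G G' by auto
    then show ?thesis
      using branching_system_reverse[OF T'(1)] by blast
  qed
qed

text \<open>
  The edges in \<open>F\<close> and the vertex \<open>z\<close> disappear, and the edge
  \<open>e\<close>, formerly at \<open>z\<close>, is reused as an edge with the ends
  \<open>p\<close>; so no identifier outside the given edge set is required.
\<close>

definition split_off :: "('v, 'e) multigraph \<Rightarrow> 'v \<Rightarrow> 'e \<Rightarrow> 'e set \<Rightarrow> 'v set \<Rightarrow> ('v, 'e) multigraph" where
  "split_off G z e F p =
     \<lparr>mg_verts = mg_verts G - {z}, mg_edges = mg_edges G - F, mg_ends = (mg_ends G)(e := p)\<rparr>"

context three_connected_circuit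
begin

lemma split_off_circuit:
  assumes z: "z \<in> V" "{e \<in> E. z \<in> ends e} = {ex, ey, ew}" "distinct [ex, ey, ew]"
    and nb: "nbrs z = {x, y, w}" "distinct [x, y, w]"
    and free: "\<And>A. \<not> blocker z w A"
  shows "generic_circuit (split_off G z ex {ey, ew} {x, y})"
proof -
  let ?G = "split_off G z ex {ey, ew} {x, y}"
  have xyw: "{x, y, w} \<subseteq> V" "z \<notin> {x, y, w}"
    using nb nbrs_sub[of z] nbrs_irrefl[of z] by auto
  have exyw: "ex \<in> E" "ey \<in> E" "ew \<in> E"
    using z(2) by auto
  have off: "z \<notin> ends e" if "e \<in> E" "e \<notin> {ex, ey, ew}" for e
    using z(2) that by auto
  have G: "mg_verts ?G = V - {z}" "mg_edges ?G = E - {ey, ew}" "mg_ends ?G = ends(ex := {x, y})"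
    by (simp_all add: split_off_def)
  have "fin_multigraph ?G"
  proof
    show "finite (mg_verts ?G)" "finite (mg_edges ?G)"
      using finite_mg_verts finite_mg_edges by (simp_all add: G)
    fix e assume e: "e \<in> mg_edges ?G"
    show "mg_ends ?G e \<subseteq> mg_verts ?G" "card (mg_ends ?G e) = 2"
      using e off[of e] mg_ends_in_verts[of e] card_mg_ends[of e] xyw nb(2) by (auto simp: G)
  qed
  moreover have "int (card (mg_edges ?G)) = 2 * int (card (mg_verts ?G)) - 2"
  proof -
    have "card (E - {ey, ew}) = card E - 2"
      using exyw z(3) by (simp add: card_Diff_subset)
    moreover have "int (card E) = 2 * int (card V) - 2"
      using circuit by (simp add: generic_circuit_def)
    ultimately show ?thesis
      using z(1) card_V5 by (simp add: G of_nat_diff)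
  qed
  moreover have "2 * int (card (mg_verts ?G)) - 2 > 0"
    using z(1) card_V5 by (simp add: G of_nat_diff)
  moreover have "int (card (mg_edges (mg_induced ?G X))) \<le> 2 * int (card X) - 3"
    if X: "X \<subset> mg_verts ?G" "2 \<le> int (card X)" for X
  proof -
    have XV: "X \<subset> V" "z \<notin> X" "2 \<le> card X" "insert z X \<noteq> V"
      using X z(1) by (auto simp: G)
    have sub: "mg_edges (mg_induced ?G X) \<subseteq> edges_in X \<union> {e. e = ex \<and> {x, y} \<subseteq> X}"
      by (auto simp: mg_induced_def G edges_in_def split: if_splits)
    show ?thesis
    proof (cases "{x, y} \<subseteq> X")
      case False
      then have "card (mg_edges (mg_induced ?G X)) \<le> card (edges_in X)"
        using sub by (intro card_mono) auto
      then show ?thesis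
        using edge_count_le[OF XV(1,3)] by (simp add: edge_count_def)
    next
      case True
      \<comment> \<open>A critical set that contains both ends of the new edge would be a blocker, or it would
          contain all neighbours of \<open>z\<close>.\<close>
      have "edge_count X \<noteq> 2 * int (card X) - 3"
      proof
        assume "edge_count X = 2 * int (card X) - 3"
        then have crit: "critical X"
          using XV by (simp add: critical_def)
        have "w \<in> X"
          using free[of X] crit XV(2) True nb by (auto simp: blocker_def)
        then have "nbrs z \<inter> X = nbrs z"
          using True nb by auto
        then show False
          using tight_V[OF crit z(1) XV(2)] XV(4) nb by simp
      qed
      then have "edge_count X + 1 \<le> 2 * int (card X) - 3"
        using edge_count_le[OF XV(1,3)] by simp
      moreover have "card (mg_edges (mg_induced ?G X)) \<le> card (insert ex (edges_in X))"
        using sub by (intro card_mono) auto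
      then have "card (mg_edges (mg_induced ?G X)) \<le> card (edges_in X) + 1"
        by (auto simp: card_insert_if split: if_splits)
      ultimately show ?thesis
        by (simp add: edge_count_def)
    qed
  qed
  ultimately show ?thesis
    by (auto simp: generic_circuit_def)
qed

lemma admissible_step:
  assumes st: "s \<in> V" "t \<in> V" "s \<noteq> t" and f: "f \<in> E" "s \<in> ends f"
    and IH: "\<And>(G' :: ('v, 'e) multigraph). card (mg_verts G') < card V \<Longrightarrow> generic_circuit G' \<Longrightarrow> s \<in> mg_verts G' \<Longrightarrow>
      t \<in> mg_verts G' \<Longrightarrow> f \<in> mg_edges G' \<Longrightarrow> s \<in> mg_ends G' f \<Longrightarrow>
      \<exists>T lo hi pos. branching_system G' s t T lo hi pos \<and> f \<notin> T"
  shows "\<exists>T lo hi pos. branching_system G s t T lo hi pos \<and> f \<notin> T"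
proof -
  obtain u where u: "u \<in> nbrs s" "ends f = {s, u}"
    using edge_at[OF f] by blast
  obtain z where z: "admissible z" "z \<notin> {s, t, u}"
    using exists_admissible[OF u(1)] by blast
  obtain w where w: "w \<in> nbrs z" "\<And>A. \<not> blocker z w A" and node: "node z"
    using z(1) by (auto simp: admissible_def)
  have zV: "z \<in> V" and c3: "card (nbrs z) = 3"
    using node by (auto simp: node_def)
  have "card (nbrs z - {w}) = 2"
    using c3 w(1) by simp
  then obtain x y where xy: "nbrs z - {w} = {x, y}" "x \<noteq> y"
    by (auto simp: card_2_iff)
  then have nb: "nbrs z = {x, y, w}" "distinct [x, y, w]"
    using w(1) by auto
  then have "x \<in> nbrs z" "y \<in> nbrs z" "w \<in> nbrs z"
    by simp_all
  then obtain ex ey ew where e: "ex \<in> E" "ends ex = {z, x}" "ey \<in> E" "ends ey = {z, y}" "ew \<in> E" "ends ew = {z, w}"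
    unfolding nbrs_def mem_Collect_eq by (elim bexE) rule
  have zxyw: "z \<notin> {x, y, w}" "{x, y, w} \<subseteq> V"
    using nb nbrs_irrefl[of z] nbrs_sub[of z] by auto
  have dist: "distinct [ex, ey, ew]"
    using e nb(2) zxyw by (auto simp: doubleton_eq_iff)
  have inc: "{e \<in> E. z \<in> ends e} = {ex, ey, ew}"
  proof
    show "{e \<in> E. z \<in> ends e} \<subseteq> {ex, ey, ew}"
    proof
      fix g assume g: "g \<in> {e \<in> E. z \<in> ends e}"
      then obtain v where v: "ends g = {z, v}" "v \<in> nbrs z"
        using edge_at[of g z] by blast
      then have "v \<in> {x, y, w}"
        using nb(1) by simp
      then have "ends g \<in> {ends ex, ends ey, ends ew}"
        using v e by auto
      then show "g \<in> {ex, ey, ew}"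
        using g e(1,3,5) by (simp add: inj_on_eq_iff[OF ends_inj])
    qed
  qed (use e in auto)
  let ?G = "split_off G z ex {ey, ew} {x, y}"
  let ?E0 = "E - {ex, ey, ew}"
  have fE: "f \<in> ?E0"
    using f(1) u(2) z(2) e by auto
  have circ: "generic_circuit ?G"
    by (rule split_off_circuit[OF zV inc dist nb w(2)])
  have Gp: "mg_verts ?G = V - {z}" "mg_edges ?G = insert ex ?E0"
    using e dist by (auto simp: split_off_def)
  have smaller: "card (mg_verts ?G) < card V"
    using zV card_V5 by (simp add: Gp)
  have "\<exists>T lo hi pos. branching_system ?G s t T lo hi pos \<and> f \<notin> T"
    by (rule IH[OF smaller circ]) (use st z(2) fE f(2) in \<open>auto simp: Gp split_off_def\<close>)
  then obtain T lo hi pos where sys: "branching_system ?G s t T lo hi pos" and fT: "f \<notin> T"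
    by blast
  have ends0: "ends g = mg_ends ?G g" "z \<notin> ends g" if "g \<in> ?E0" for g
    using that inc by (auto simp: split_off_def)
  have ex1: "mg_ends ?G ex = {x, y}"
    by (simp add: split_off_def)
  have E: "E = ?E0 \<union> {ex, ey, ew}" "{ex, ey, ew} \<inter> ?E0 = {}" "ex \<notin> ?E0"
    using e by auto
  have "z \<noteq> s" "z \<noteq> t"
    using z(2) by auto
  from insert_vertex_on_edge[OF finite_mg_verts zV this Gp E(3,1) dist E(2) ends0 ex1 e(2,4,6) nb(2) zxyw sys]
  obtain T' lo' hi' and pos' :: "'v \<Rightarrow> real" where
    "branching_system G s t T' lo' hi' pos'" "\<forall>f\<in>?E0. f \<in> T' \<longleftrightarrow> f \<in> T"
    by blast
  then show ?thesis
    using fE fT by blast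
qed

end

section \<open>Gluing along a 2-separation\<close>

text \<open>
  All of \<open>B\<close> except \<open>u\<close> and \<open>v\<close> fits, after scaling, between
  \<open>u\<close> and the next vertex of \<open>A\<close>.
\<close>

lemma merge_positions_between:
  fixes p q :: "'v \<Rightarrow> real"
  assumes fin: "finite A" and AB: "A \<inter> B = {u, v}"
    and inj: "inj_on p A" "inj_on q B" and less: "p u < p v"
    and B: "\<And>x. x \<in> B \<Longrightarrow> q u \<le> q x \<and> q x \<le> q v"
  obtains r :: "'v \<Rightarrow> real" where "inj_on r (A \<union> B)" "\<And>x y. x \<in> A \<Longrightarrow> y \<in> A \<Longrightarrow> p x < p y \<Longrightarrow> r x < r y"
    "\<And>x y. x \<in> B \<Longrightarrow> y \<in> B \<Longrightarrow> q x < q y \<Longrightarrow> r x < r y"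
proof -
  have uv: "u \<in> A" "v \<in> A" "u \<in> B" "v \<in> B"
    using AB by auto
  define S where "S = p ` {x \<in> A. p u < p x}"
  have S: "finite S" "p v \<in> S"
    using fin uv less by (auto simp: S_def)
  define d where "d = Min S - p u"
  have "Min S \<in> S"
    using S Min_in by blast
  then have d: "0 < d"
    by (auto simp: d_def S_def)
  have gap: "p u + d \<le> p x" if "x \<in> A" "p u < p x" for x
    using Min_le[OF S(1)] that by (simp add: d_def S_def)
  have q: "q u < q x \<and> q x < q v" if "x \<in> B - A" for x
    using that B[of x] inj(2) uv by (fastforce simp: inj_on_def order_less_le)
  have quv: "q u < q v"
    using B[OF uv(4)] inj(2) uv less by (fastforce simp: inj_on_def order_less_le)
  define k where "k = d / (q v - q u)"
  have k: "0 < k" "k * (q v - q u) = d"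
    using d quv by (auto simp: k_def)
  define r where "r x = (if x \<in> A then p x else p u + k * (q x - q u))" for x
  have inner: "p u < r x \<and> r x < p u + d" if "x \<in> B - A" for x
  proof -
    have "0 < k * (q x - q u)" "k * (q x - q u) < k * (q v - q u)"
      using q[OF that] k(1) by auto
    then show ?thesis
      using that k(2) by (simp add: r_def)
  qed
  have rA: "r x = p x" if "x \<in> A" for x
    using that by (simp add: r_def)
  have monoB: "r x < r y" if xy: "x \<in> B" "y \<in> B" "q x < q y" for x y
  proof -
    consider "x \<in> A" "y \<in> A" | "x \<in> A" "y \<notin> A" | "x \<notin> A" "y \<in> A" | "x \<notin> A" "y \<notin> A" by blast
    then show ?thesis
    proof cases
      case 1
      then have "x \<in> {u, v}" "y \<in> {u, v}"
        using AB xy by blast+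
      then have "x = u" "y = v"
        using xy(3) quv by auto
      then show ?thesis
        using less uv rA by simp
    next
      case 2
      then have "x \<in> {u, v}"
        using AB xy by blast
      then have "x = u"
        using q[of y] 2 xy by auto
      then show ?thesis
        using inner[of y] 2 xy uv rA by simp
    next
      case 3
      then have "y \<in> {u, v}"
        using AB xy by blast
      then have "y = v"
        using q[of x] 3 xy by auto
      then show ?thesis
        using inner[of x] 3 xy uv rA gap[of v] less by simp
    next
      case 4
      then show ?thesis
        using k(1) xy(3) by (simp add: r_def)
    qed
  qed
  have "inj_on r (A \<union> B)"
  proof (rule inj_onI, rule ccontr)
    fix x y assume xy: "x \<in> A \<union> B" "y \<in> A \<union> B" "r x = r y" "x \<noteq> y"
    have no: "r a \<noteq> r b" if "a \<in> A" "b \<in> B - A" for a b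
    proof -
      have "r a = p a"
        using that by (simp add: r_def)
      moreover have "p a \<le> p u \<or> p u + d \<le> p a"
        using gap[OF that(1)] by linarith
      ultimately show ?thesis
        using inner[OF that(2)] by auto
    qed
    consider "x \<in> A" "y \<in> A" | "x \<in> A" "y \<in> B - A" | "x \<in> B - A" "y \<in> A" | "x \<in> B - A" "y \<in> B - A"
      using xy by blast
    then show False
    proof cases
      case 1
      then show False using xy(3,4) inj(1) rA by (auto simp: inj_on_def)
    next
      case 2
      then show False using no xy by blast
    next
      case 3
      then show False using no[of y x] xy by simp
    next
      case 4
      then have "q x \<noteq> q y" using xy(4) inj(2) by (auto simp: inj_on_def)
      then show False using monoB[of x y] monoB[of y x] 4 xy(3) by fastforce
    qed
  qed
  then show thesis
    using that[of r] monoB rA by simp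
qed

text \<open>
  As \<open>v\<close> is last in \<open>A\<close> and \<open>u\<close> is first in \<open>B\<close>,
  one can list \<open>A - {v}\<close> first and then \<open>B - {u}\<close>.
\<close>

lemma merge_positions_after:
  fixes p q :: "'v \<Rightarrow> real"
  assumes fin: "finite A" "finite B" and AB: "A \<inter> B = {u, v}"
    and inj: "inj_on p A" "inj_on q B"
    and A: "\<And>x. x \<in> A \<Longrightarrow> p x \<le> p v" and B: "\<And>x. x \<in> B \<Longrightarrow> q u \<le> q x"
  obtains r :: "'v \<Rightarrow> real" where "inj_on r (A \<union> B)" "\<And>x y. x \<in> A \<Longrightarrow> y \<in> A \<Longrightarrow> p x < p y \<Longrightarrow> r x < r y"
    "\<And>x y. x \<in> B \<Longrightarrow> y \<in> B \<Longrightarrow> q x < q y \<Longrightarrow> r x < r y"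
proof -
  define K where "K = p v - q u + 1"
  have K: "p x < q y + K" if "x \<in> A" "y \<in> B" for x y
    using A[OF that(1)] B[OF that(2)] by (simp add: K_def)
  define r where "r x = (if x \<in> A - {v} then p x else q x + K)" for x
  have 1: "r x = p x" if "x \<in> A" "x \<noteq> v" for x
    using that by (simp add: r_def)
  have 2: "r x = q x + K" if "x \<in> B" "x \<notin> A \<or> x = v" for x
    using that by (auto simp: r_def)
  have uv: "u \<in> A" "v \<in> A" "u \<in> B" "v \<in> B"
    using AB by auto
  have monoA: "r x < r y" if "x \<in> A" "y \<in> A" "p x < p y" for x y
  proof (cases "y = v")
    case True
    then have "x \<noteq> v"
      using that(3) by auto
    then show ?thesis
      using 1[of x] 2[of v] that(1) True K[of x v] uv by simp
  next
    case False
    moreover have "x \<noteq> v"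
      using A[OF that(2)] that(3) by auto
    ultimately show ?thesis
      using 1 that by simp
  qed
  have monoB: "r x < r y" if "x \<in> B" "y \<in> B" "q x < q y" for x y
  proof (cases "x \<in> A \<and> x \<noteq> v")
    case True
    have "y \<noteq> u"
      using B[OF that(1)] that(3) by auto
    then have "y \<notin> A \<or> y = v"
      using AB that(2) by blast
    then show ?thesis
      using True 1[of x] 2[OF that(2)] K that by simp
  next
    case False
    have "y \<noteq> u"
      using B[OF that(1)] that(3) by auto
    then have "y \<notin> A \<or> y = v"
      using AB that(2) by blast
    then show ?thesis
      using False 2[of x] 2[OF that(2)] that by auto
  qed
  have "inj_on r (A \<union> B)"
  proof (rule inj_onI, rule ccontr)
    fix x y assume xy: "x \<in> A \<union> B" "y \<in> A \<union> B" "r x = r y" "x \<noteq> y"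
    have no: "r a \<noteq> r b" if "a \<in> A" "a \<noteq> v" "b \<in> B" "b \<notin> A \<or> b = v" for a b
      using 1[OF that(1,2)] 2[OF that(3,4)] K[OF that(1,3)] by simp
    consider "x \<in> A" "y \<in> A" "x \<noteq> v" "y \<noteq> v" | "x \<in> A" "x \<noteq> v" "y \<in> B" "y \<notin> A \<or> y = v"
      | "x \<in> B" "x \<notin> A \<or> x = v" "y \<in> A" "y \<noteq> v"
      | "x \<in> B" "x \<notin> A \<or> x = v" "y \<in> B" "y \<notin> A \<or> y = v"
      using xy uv by blast
    then show False
    proof cases
      case 1
      then show False using xy(3,4) inj(1) \<open>\<And>x. x \<in> A \<Longrightarrow> x \<noteq> v \<Longrightarrow> r x = p x\<close> by (auto simp: inj_on_def)
    next
      case 2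
      then show False using no xy by blast
    next
      case 3
      then show False using no[of y x] xy by simp
    next
      case 4
      then have "q x = q y" using 2[of x] 2[of y] xy(3) by simp
      then show False using 4 xy(4) inj(2) by (auto simp: inj_on_def)
    qed
  qed
  then show thesis
    using that[of r] monoA monoB by blast
qed

text \<open>
  The vertex \<open>u\<close> is the root of the out-branching of \<open>GB\<close>, and
  \<open>v\<close> is the root of the in-branching of \<open>GA\<close> or of \<open>GB\<close>. So,
  with \<open>g\<close> and \<open>h\<close> kept, \<open>u\<close> would have two leaving edges and
  at most one entering edge, and \<open>v\<close> two entering edges and at most one leaving edge.
  One of \<open>g\<close>, \<open>h\<close> is an entering edge of \<open>v\<close> and the other
  one a leaving edge of \<open>u\<close>, so their deletion removes exactly the excess.
\<close>

lemma glue_systems: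
  fixes r :: "'v \<Rightarrow> real"
  assumes V: "mg_verts G = mg_verts GA \<union> mg_verts GB" "mg_verts GA \<inter> mg_verts GB = {u, v}" "u \<noteq> v"
    and E: "mg_edges G = EA \<union> EB" "EA \<inter> EB = {}" "mg_edges GA = insert g EA" "mg_edges GB = insert h EB" "g \<notin> EA" "h \<notin> EB"
    and ends: "\<And>e. e \<in> EA \<Longrightarrow> mg_ends G e = mg_ends GA e" "\<And>e. e \<in> EB \<Longrightarrow> mg_ends G e = mg_ends GB e"
    and fin: "fin_multigraph GA" "fin_multigraph GB"
    and sysA: "branching_system GA sA tA TA loA hiA p" and sysB: "branching_system GB sB tB TB loB hiB q"
    and g: "loA g = u" "hiA g = v" and h: "loB h = u" "hiB h = v"
    and opp: "g \<in> TA \<longleftrightarrow> h \<notin> TB"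
    and r: "inj_on r (mg_verts G)"
      "\<And>x y. x \<in> mg_verts GA \<Longrightarrow> y \<in> mg_verts GA \<Longrightarrow> p x < p y \<Longrightarrow> r x < r y"
      "\<And>x y. x \<in> mg_verts GB \<Longrightarrow> y \<in> mg_verts GB \<Longrightarrow> q x < q y \<Longrightarrow> r x < r y"
    and roots: "sA \<in> mg_verts GA" "tA \<in> mg_verts GA" "s = sA" "sB = u" "t = tA \<and> tB = v \<or> t = tB \<and> tA = v \<and> tB \<notin> mg_verts GA"
  shows "\<exists>lo hi. branching_system G s t ((TA - {g}) \<union> (TB - {h})) lo hi r"
proof -
  let ?A = "mg_verts GA" and ?B = "mg_verts GB" and ?T = "(TA - {g}) \<union> (TB - {h})"
  note A = system_edges[OF sysA] and B = system_edges[OF sysB]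
  have gh: "g \<in> mg_edges GA" "h \<in> mg_edges GB"
    using E by auto
  have uv: "u \<in> ?A" "v \<in> ?A" "u \<in> ?B" "v \<in> ?B"
    using V by auto
  define lo where "lo e = (if e \<in> EA then loA e else loB e)" for e
  define hi where "hi e = (if e \<in> EA then hiA e else hiB e)" for e
  have TA: "TA - {g} \<subseteq> EA" and TB: "TB - {h} \<subseteq> EB"
    using A(1) B(1) E by auto
  have fA: "lo e = loA e" "hi e = hiA e" if "e \<in> EA" for e
    using that by (simp_all add: lo_def hi_def)
  have fB: "lo e = loB e" "hi e = hiB e" if "e \<in> EB" for e
    using that E(2) by (auto simp: lo_def hi_def)
  have edges: "mg_ends G e = {lo e, hi e} \<and> r (lo e) < r (hi e)" if e: "e \<in> mg_edges G" for e
  proof (cases "e \<in> EA")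
    case True
    then have "e \<in> mg_edges GA"
      using E by simp
    then show ?thesis
      using A(3,4)[of e] fin_multigraph.mg_ends_in_verts[OF fin(1), of e] ends(1)[OF True] fA[OF True] r(2) by simp
  next
    case False
    then have eB: "e \<in> EB" "e \<in> mg_edges GB"
      using E e by auto
    then show ?thesis
      using B(3,4)[of e] fin_multigraph.mg_ends_in_verts[OF fin(2), of e] ends(2)[OF eB(1)] fB[OF eB(1)] r(3) by simp
  qed
  have hA: "bij_betw hi (TA - {g}) (?A - {sA} - (if g \<in> TA then {v} else {}))"
  proof -
    have "bij_betw hiA (TA - {g}) (?A - {sA} - (if g \<in> TA then {v} else {}))"
    proof (cases "g \<in> TA")
      case True
      then have "v \<in> ?A - {sA}"
        using bij_betw_apply[OF A(5) True] g by simp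
      then show ?thesis
        using bij_betw_DiffI[OF A(5) bij_betw_singletons[of hiA g]] True g by simp
    qed (use A(5) in simp)
    then show ?thesis
      using fA(2) TA by (subst bij_betw_cong[of _ hi hiA]) auto
  qed
  have hB: "bij_betw hi (TB - {h}) (?B - {sB} - (if h \<in> TB then {v} else {}))"
  proof -
    have "bij_betw hiB (TB - {h}) (?B - {sB} - (if h \<in> TB then {v} else {}))"
    proof (cases "h \<in> TB")
      case True
      then have "v \<in> ?B - {sB}"
        using bij_betw_apply[OF B(5) True] h by simp
      then show ?thesis
        using bij_betw_DiffI[OF B(5) bij_betw_singletons[of hiB h]] True h by simp
    qed (use B(5) in simp)
    then show ?thesis
      using fB(2) TB by (subst bij_betw_cong[of _ hi hiB]) auto
  qed
  have lA: "bij_betw lo (EA - TA) (?A - {tA} - (if g \<notin> TA then {u} else {}))"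
  proof -
    have "bij_betw loA (mg_edges GA - TA - {g}) (?A - {tA} - (if g \<notin> TA then {u} else {}))"
    proof (cases "g \<in> TA")
      case False
      then have *: "g \<in> mg_edges GA - TA"
        using gh by simp
      then have "u \<in> ?A - {tA}"
        using bij_betw_apply[OF A(6) *] g by simp
      then show ?thesis
        using bij_betw_DiffI[OF A(6) bij_betw_singletons[of loA g]] * g by simp
    qed (use A(6) in simp)
    moreover have "mg_edges GA - TA - {g} = EA - TA"
      using E by auto
    ultimately show ?thesis
      using fA(1) by (subst bij_betw_cong[of _ lo loA]) auto
  qed
  have lB: "bij_betw lo (EB - TB) (?B - {tB} - (if h \<notin> TB then {u} else {}))"
  proof -
    have "bij_betw loB (mg_edges GB - TB - {h}) (?B - {tB} - (if h \<notin> TB then {u} else {}))"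
    proof (cases "h \<in> TB")
      case False
      then have *: "h \<in> mg_edges GB - TB"
        using gh by simp
      then have "u \<in> ?B - {tB}"
        using bij_betw_apply[OF B(6) *] h by simp
      then show ?thesis
        using bij_betw_DiffI[OF B(6) bij_betw_singletons[of loB h]] * h by simp
    qed (use B(6) in simp)
    moreover have "mg_edges GB - TB - {h} = EB - TB"
      using E by auto
    ultimately show ?thesis
      using fB(1) by (subst bij_betw_cong[of _ lo loB]) auto
  qed
  have "sA \<noteq> v" if "g \<in> TA"
    using bij_betw_apply[OF A(5) that] g by auto
  have tne: "tA \<noteq> u" if "g \<notin> TA"
    using bij_betw_apply[OF A(6), of g] that gh g by auto
  have "bij_betw hi ?T (mg_verts G - {s})"
  proof -
    have "(?A - {sA} - (if g \<in> TA then {v} else {})) \<union> (?B - {sB} - (if h \<in> TB then {v} else {})) = mg_verts G - {s}"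
      using V roots opp \<open>g \<in> TA \<Longrightarrow> sA \<noteq> v\<close> by (cases "g \<in> TA") auto
    moreover have "(?A - {sA} - (if g \<in> TA then {v} else {})) \<inter> (?B - {sB} - (if h \<in> TB then {v} else {})) = {}"
      using V roots opp by (cases "g \<in> TA") auto
    ultimately show ?thesis
      using bij_betw_combine[OF hA hB] by simp
  qed
  moreover have "bij_betw lo (mg_edges G - ?T) (mg_verts G - {t})"
  proof -
    have "(?A - {tA} - (if g \<notin> TA then {u} else {})) \<union> (?B - {tB} - (if h \<notin> TB then {u} else {})) = mg_verts G - {t}"
      using V roots opp tne by (cases "g \<in> TA") auto
    moreover have "(?A - {tA} - (if g \<notin> TA then {u} else {})) \<inter> (?B - {tB} - (if h \<notin> TB then {u} else {})) = {}"
      using V roots opp by (cases "g \<in> TA") auto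
    moreover have "mg_edges G - ?T = (EA - TA) \<union> (EB - TB)"
      using E TA TB by auto
    ultimately show ?thesis
      using bij_betw_combine[OF lA lB] by simp
  qed
  ultimately have "branching_system G s t ?T lo hi r"
    using edges r(1) TA TB E(1) unfolding branching_system_def by blast
  then show ?thesis by blast
qed

text \<open>
  One side of a 2-separation with an edge that joins the two cut vertices \<open>p\<close>; the
  identifier \<open>g\<close> of this edge is taken from the other side.
\<close>

definition side_with_edge :: "('v, 'e) multigraph \<Rightarrow> 'v set \<Rightarrow> 'e \<Rightarrow> 'v set \<Rightarrow> ('v, 'e) multigraph" where
  "side_with_edge G A g p =
     \<lparr>mg_verts = A, mg_edges = insert g {e \<in> mg_edges G. mg_ends G e \<subseteq> A}, mg_ends = (mg_ends G)(g := p)\<rparr>"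

context circuit
begin

text \<open>
  The two sides share two vertices, so the sum of their sparsity bounds is exactly the number of
  edges of the circuit. Both bounds are attained, and no edge joins the two cut vertices.
\<close>

lemma two_separation_critical:
  assumes sep: "two_separation G A B"
  shows "critical A" "critical B" "edges_in (A \<inter> B) = {}"
proof -
  have A: "A \<union> B = V" "card (A \<inter> B) = 2" "A \<subset> V" "B \<subset> V"
    using sep by (auto simp: two_separation_def)
  then have fin: "finite A" "finite B"
    by auto
  have "card (A \<inter> B) \<le> card A" "card (A \<inter> B) \<le> card B"
    using fin by (auto intro: card_mono)
  then have c: "2 \<le> card A" "2 \<le> card B"
    using A(2) by simp_all
  have E: "edges_in A \<union> edges_in B = E"
    using sep by (auto simp: two_separation_def edges_in_def)
  have "edges_in V = E"
    using mg_ends_in_verts by (auto simp: edges_in_def)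
  then have "edge_count A + edge_count B = edge_count V + edge_count (A \<inter> B)"
    using edge_count_card_Un[of A B] E by (simp add: edge_count_def)
  moreover have "int (card A) + int (card B) = int (card V) + 2"
    using card_Un_Int[OF fin] A by simp
  moreover have "edge_count A \<le> 2 * int (card A) - 3" "edge_count B \<le> 2 * int (card B) - 3" "0 \<le> edge_count (A \<inter> B)"
    using edge_count_le A(3,4) c by (auto simp: edge_count_def)
  ultimately have "edge_count A = 2 * int (card A) - 3" "edge_count B = 2 * int (card B) - 3" "edge_count (A \<inter> B) = 0"
    using edge_count_V by linarith+
  then show "critical A" "critical B" "edges_in (A \<inter> B) = {}"
    using A c by (auto simp: critical_def edge_count_def)
qed

text \<open>
  A set that violates sparsity contains both ends of the new edge and is critical in
  \<open>G\<close>. Together with the other side it would span too many edges, because the cut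
  vertices are nonadjacent.
\<close>

lemma side_circuit:
  assumes sep: "two_separation G A B" and uv: "A \<inter> B = {u, v}" "u \<noteq> v" and g: "g \<in> edges_in B"
  shows "generic_circuit (side_with_edge G A g {u, v})"
proof -
  let ?G = "side_with_edge G A g {u, v}"
  note crit = two_separation_critical[OF sep]
  have A: "A \<subset> V" "B \<subset> V" "2 \<le> card A" "A \<union> B = V" "edge_count A = 2 * int (card A) - 3"
    "edge_count B = 2 * int (card B) - 3" "finite A" "finite B"
    using crit sep by (auto simp: critical_def two_separation_def)
  have gA: "g \<notin> edges_in A"
    using crit(3) g by (auto simp: edges_in_Int)
  have G: "mg_verts ?G = A" "mg_edges ?G = insert g (edges_in A)" "mg_ends ?G = ends(g := {u, v})"
    by (simp_all add: side_with_edge_def edges_in_def)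
  have "fin_multigraph ?G"
  proof
    show "finite (mg_verts ?G)" "finite (mg_edges ?G)"
      using A by (simp_all add: G)
    fix e assume e: "e \<in> mg_edges ?G"
    show "mg_ends ?G e \<subseteq> mg_verts ?G" "card (mg_ends ?G e) = 2"
      using e uv card_mg_ends[of e] by (auto simp: G edges_in_def)
  qed
  moreover have "int (card (mg_edges ?G)) = 2 * int (card (mg_verts ?G)) - 2"
    using gA A(5) by (simp add: G edge_count_def)
  moreover have "2 * int (card (mg_verts ?G)) - 2 > 0"
    using A(3) by (simp add: G)
  moreover have "int (card (mg_edges (mg_induced ?G X))) \<le> 2 * int (card X) - 3"
    if X: "X \<subset> mg_verts ?G" "2 \<le> int (card X)" for X
  proof -
    have XA: "X \<subset> A" "X \<subset> V" "2 \<le> card X" "finite X"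
      using X A by (auto simp: G intro: finite_subset)
    have sub: "mg_edges (mg_induced ?G X) \<subseteq> edges_in X \<union> {e. e = g \<and> {u, v} \<subseteq> X}"
      by (auto simp: mg_induced_def G edges_in_def split: if_splits)
    show ?thesis
    proof (cases "{u, v} \<subseteq> X")
      case False
      then have "card (mg_edges (mg_induced ?G X)) \<le> card (edges_in X)"
        using sub by (intro card_mono) auto
      then show ?thesis
        using edge_count_le[OF XA(2,3)] by (simp add: edge_count_def)
    next
      case True
      have XB: "X \<inter> B = {u, v}"
        using True uv(1) XA(1) by blast
      obtain a where "a \<in> A" "a \<notin> X"
        using XA(1) by blast
      then have "a \<notin> X \<union> B" "a \<in> V"
        using uv(1) True A(1) by blast+
      then have "X \<union> B \<subset> V"
        using XA(2) A(2) by blast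
      moreover have cXB: "card (X \<union> B) + 2 = card X + card B"
        using card_Un_Int[OF XA(4) A(8)] XB uv(2) by simp
      moreover have "card X \<le> card (X \<union> B)"
        using XA(4) A(8) by (intro card_mono) auto
      ultimately have "edge_count (X \<union> B) \<le> 2 * int (card (X \<union> B)) - 3"
        using XA(3) by (intro edge_count_le) auto
      moreover have "edge_count (X \<inter> B) = 0"
        using crit(3) uv(1) XB by (simp add: edge_count_def)
      ultimately have "edge_count X + 1 \<le> 2 * int (card X) - 3"
        using edge_count_supermodular[of X B] A(6) cXB by linarith
      moreover have "card (mg_edges (mg_induced ?G X)) \<le> card (insert g (edges_in X))"
        using sub by (intro card_mono) auto
      then have "card (mg_edges (mg_induced ?G X)) \<le> card (edges_in X) + 1"
        by (auto simp: card_insert_if split: if_splits)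
      ultimately show ?thesis
        by (simp add: edge_count_def)
    qed
  qed
  ultimately show ?thesis
    by (auto simp: generic_circuit_def)
qed

lemma other_edge_at:
  assumes "s \<in> V"
  obtains f where "f \<in> E" "s \<in> ends f" "f \<noteq> e"
proof -
  have sub: "E \<subseteq> edges_in (V - {s}) \<union> {f \<in> E. s \<in> ends f}"
    using mg_ends_in_verts by (auto simp: edges_in_def)
  have "2 \<le> card {f \<in> E. s \<in> ends f}"
  proof -
    have "card E \<le> card (edges_in (V - {s}) \<union> {f \<in> E. s \<in> ends f})"
      using sub finite_mg_edges by (intro card_mono) auto
    also have "\<dots> \<le> card (edges_in (V - {s})) + card {f \<in> E. s \<in> ends f}"
      by (rule card_Un_le)
    finally have 1: "int (card E) \<le> edge_count (V - {s}) + int (card {f \<in> E. s \<in> ends f})"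
      by (simp add: edge_count_def)
    have "V \<noteq> {s}"
      using card_V by auto
    then have "V - {s} \<noteq> {}"
      using assms by blast
    then have "edge_count (V - {s}) \<le> 2 * int (card (V - {s})) - 2"
      by (intro edge_count_le_nonempty) auto
    moreover have "int (card (V - {s})) = int (card V) - 1"
      using assms card_V by (simp add: of_nat_diff)
    moreover have "int (card E) = 2 * int (card V) - 2"
      using circuit by (simp add: generic_circuit_def)
    ultimately show ?thesis
      using 1 by linarith
  qed
  then have "\<not> {f \<in> E. s \<in> ends f} \<subseteq> {e}"
    using card_mono[of "{e}" "{f \<in> E. s \<in> ends f}"] by auto
  then show thesis
    using that by blast
qed

end

text \<open>
  An edge at \<open>s\<close> is put into \<open>T\<close> by keeping another edge at
  \<open>s\<close> out of it.
\<close>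

lemma system_with_first_edge_iff:
  fixes G :: "('v, 'e) multigraph"
  assumes circ: "generic_circuit G" and s: "s \<in> mg_verts G"
    and H: "\<And>f. f \<in> mg_edges G \<Longrightarrow> s \<in> mg_ends G f \<Longrightarrow>
      \<exists>T lo hi pos. branching_system G s t T lo hi pos \<and> f \<notin> T"
    and e: "e \<in> mg_edges G" "s \<in> mg_ends G e"
  shows "\<exists>T lo hi pos. branching_system G s t T lo hi pos \<and> (e \<in> T \<longleftrightarrow> b)"
proof -
  interpret circuit G by unfold_locales fact
  show ?thesis
  proof (cases b)
    case False
    then show ?thesis
      using H[OF e] by blast
  next
    case True
    obtain f where f: "f \<in> E" "s \<in> ends f" "f \<noteq> e"
      using other_edge_at[OF s] by blast
    obtain T lo hi pos where "branching_system G s t T lo hi pos" "f \<notin> T"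
      using H[OF f(1,2)] by blast
    moreover from this have "e \<in> T"
      using other_edges_at_out_root[OF fin_multigraph_axioms _ e f(1,2) _ f(3)[symmetric]] by blast
    ultimately show ?thesis
      using True by blast
  qed
qed

context circuit
begin

text \<open>
  If \<open>t\<close> lies on the side \<open>A\<close> of the edge \<open>f\<close>, then the
  system of that side has the roots \<open>s\<close>, \<open>t\<close>, and the other side has the
  ends of the new edge as its roots, in the order in which the first system has them. Otherwise the
  first system leads from \<open>s\<close> to a cut vertex \<open>v\<close>, and the second one from
  the other cut vertex \<open>u\<close> to \<open>t\<close>; as \<open>u\<close> comes first there
  and \<open>v\<close> comes last in the first system, the new edges have the same direction.
\<close>

lemma two_separation_step:
  assumes sep: "two_separation G A B"
    and st: "s \<in> V" "t \<in> V" "s \<noteq> t" and f: "f \<in> E" "s \<in> ends f" and fA: "ends f \<subseteq> A"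
    and IH: "\<And>(G' :: ('v, 'e) multigraph) s t f. card (mg_verts G') < card V \<Longrightarrow> generic_circuit G' \<Longrightarrow>
      s \<in> mg_verts G' \<Longrightarrow> t \<in> mg_verts G' \<Longrightarrow> s \<noteq> t \<Longrightarrow> f \<in> mg_edges G' \<Longrightarrow> s \<in> mg_ends G' f \<Longrightarrow>
      \<exists>T lo hi pos. branching_system G' s t T lo hi pos \<and> f \<notin> T"
  shows "\<exists>T lo hi pos. branching_system G s t T lo hi pos \<and> f \<notin> T"
proof -
  note crit = two_separation_critical[OF sep]
  have sep': "two_separation G B A"
    using sep two_separation_commute by metis
  obtain u v where uv: "A \<inter> B = {u, v}" "u \<noteq> v" "s \<noteq> v"
  proof -
    obtain u v where "A \<inter> B = {u, v}" "u \<noteq> v"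
      using sep by (auto simp: two_separation_def card_2_iff)
    then show thesis
      using that[of u v] that[of v u] by (cases "s = v") (auto simp: insert_commute)
  qed
  have AB: "A \<subset> V" "B \<subset> V" "A \<union> B = V"
    using crit sep by (auto simp: critical_def two_separation_def)
  then have cAB: "card A < card V" "card B < card V" "finite A" "finite B"
    using finite_mg_verts by (auto intro: psubset_card_mono)
  have "edges_in X \<noteq> {}" if "critical X" for X
  proof
    assume "edges_in X = {}"
    then have "2 * int (card X) = 3"
      using that by (simp add: critical_def edge_count_def)
    then show False
      by presburger
  qed
  then have "edges_in A \<noteq> {}" "edges_in B \<noteq> {}"
    using crit by blast+
  then obtain g h where gh: "g \<in> edges_in B" "h \<in> edges_in A"
    by blast
  have disj: "edges_in A \<inter> edges_in B = {}"
    using crit(3) by (simp add: edges_in_Int)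
  have E: "E = edges_in A \<union> edges_in B"
    using sep by (auto simp: two_separation_def edges_in_def)
  let ?A = "side_with_edge G A g {u, v}" and ?B = "side_with_edge G B h {u, v}"
  have cA: "generic_circuit ?A"
    by (rule side_circuit[OF sep uv(1,2) gh(1)])
  have cB: "generic_circuit ?B"
    by (rule side_circuit[OF sep' _ uv(2) gh(2)]) (use uv(1) in auto)
  have A: "mg_verts ?A = A" "mg_edges ?A = insert g (edges_in A)" "mg_ends ?A g = {u, v}" "g \<notin> edges_in A"
    "\<And>e. e \<in> edges_in A \<Longrightarrow> ends e = mg_ends ?A e"
    using gh disj by (auto simp: side_with_edge_def edges_in_def)
  have B: "mg_verts ?B = B" "mg_edges ?B = insert h (edges_in B)" "mg_ends ?B h = {u, v}" "h \<notin> edges_in B"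
    "\<And>e. e \<in> edges_in B \<Longrightarrow> ends e = mg_ends ?B e"
    using gh disj by (auto simp: side_with_edge_def edges_in_def)
  have fin: "fin_multigraph ?A" "fin_multigraph ?B"
    using cA cB by (simp_all add: generic_circuit_def)
  have fA': "f \<in> edges_in A" "f \<notin> edges_in B"
    using f fA disj by (auto simp: edges_in_def)
  have uvAB: "u \<in> A" "v \<in> A" "u \<in> B" "v \<in> B"
    using uv(1) by auto
  have sA: "s \<in> A"
    using f fA by auto
  have V: "V = mg_verts ?A \<union> mg_verts ?B"
    using AB A(1) B(1) by simp
  have IHA: "\<exists>T lo hi pos. branching_system ?A s t' T lo hi pos \<and> f \<notin> T" if "t' \<in> A" "s \<noteq> t'" for t'
    by (rule IH[OF _ cA]) (use that cAB sA A fA' f in auto)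
  have IHB: "\<exists>T lo hi pos. branching_system ?B x t' T lo hi pos \<and> (h \<in> T \<longleftrightarrow> b)"
    if "t' \<in> B" "x \<in> {u, v}" "x \<noteq> t'" for t' x b
  proof (rule system_with_first_edge_iff[OF cB])
    show "x \<in> mg_verts ?B" "h \<in> mg_edges ?B" "x \<in> mg_ends ?B h"
      using that uvAB B by auto
    show "\<exists>T lo hi pos. branching_system ?B x t' T lo hi pos \<and> f' \<notin> T"
      if "f' \<in> mg_edges ?B" "x \<in> mg_ends ?B f'" for f'
      by (rule IH[OF _ cB]) (use that \<open>t' \<in> B\<close> \<open>x \<in> {u, v}\<close> \<open>x \<noteq> t'\<close> uvAB cAB B in auto)
  qed
  have finish: ?thesis if "branching_system G s t ((TA - {g}) \<union> (TB - {h})) lo hi pos"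
    "branching_system ?B sB tB TB loB hiB q" "f \<notin> TA" for TA TB lo hi pos sB tB loB hiB q
    using that system_edges(1)[OF that(2)] B(2) fA' by blast
  show ?thesis
  proof (cases "t \<in> A")
    case True
    obtain TA loA hiA p where sysA: "branching_system ?A s t TA loA hiA p" and fTA: "f \<notin> TA"
      using IHA[OF True st(3)] by blast
    have g: "{u, v} = {loA g, hiA g}" "p (loA g) < p (hiA g)"
      using system_edges(3,4)[OF sysA, of g] A by simp_all
    have ne: "loA g \<noteq> hiA g"
      using g(2) by auto
    have x: "loA g \<in> {u, v}" "hiA g \<in> {u, v}"
      unfolding g(1) by simp_all
    then have "hiA g \<in> B"
      using uvAB by auto
    from IHB[OF this x(1) ne, of "g \<notin> TA"]
    obtain TB loB hiB q where sysB: "branching_system ?B (loA g) (hiA g) TB loB hiB q"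
      and opp: "h \<in> TB \<longleftrightarrow> g \<notin> TA"
      by blast
    have hE: "h \<in> mg_edges ?B"
      using B by simp
    have h: "loB h = loA g" "hiB h = hiA g"
      using edge_at_out_root[OF fin(2) sysB hE] edge_at_in_root[OF fin(2) sysB hE] B(3) x by auto
    have AB': "A \<inter> B = {loA g, hiA g}"
      using uv(1) g(1) by simp
    obtain r :: "'v \<Rightarrow> real" where r: "inj_on r (A \<union> B)"
      "\<And>x y. x \<in> A \<Longrightarrow> y \<in> A \<Longrightarrow> p x < p y \<Longrightarrow> r x < r y"
      "\<And>x y. x \<in> B \<Longrightarrow> y \<in> B \<Longrightarrow> q x < q y \<Longrightarrow> r x < r y"
      using merge_positions_between[OF cAB(3) AB' _ _ g(2), of q]
        system_edges(2)[OF sysA] system_edges(2)[OF sysB]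
        out_root_first[OF fin(2) sysB] in_root_last[OF fin(2) sysB] A(1) B(1) by metis
    have "\<exists>lo hi. branching_system G s t ((TA - {g}) \<union> (TB - {h})) lo hi r"
      by (rule glue_systems[where r = r, OF V _ ne E disj A(2) B(2) A(4) B(4) A(5) B(5) fin sysA sysB
            refl refl h _ _ _ _ _ _ refl refl])
        (use r A(1) B(1) AB' AB opp sA True in auto)
    then show ?thesis
      using finish sysB fTA by blast
  next
    case False
    then have tB: "t \<in> B"
      using st AB by blast
    obtain TA loA hiA p where sysA: "branching_system ?A s v TA loA hiA p" and fTA: "f \<notin> TA"
      using IHA[OF uvAB(2) uv(3)] by blast
    have gE: "g \<in> mg_edges ?A" "h \<in> mg_edges ?B"
      using A B by simp_all
    have hg: "hiA g = v"
      using edge_at_in_root[OF fin(1) sysA gE(1)] A(3) by simp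
    moreover have "{u, v} = {loA g, hiA g}"
      using system_edges(3)[OF sysA gE(1)] A(3) by simp
    ultimately have g: "loA g = u" "hiA g = v"
      using uv(2) by (auto simp: doubleton_eq_iff)
    have "u \<noteq> t"
      using False uvAB by auto
    with IHB[OF tB, of u "g \<notin> TA"]
    obtain TB loB hiB q where sysB: "branching_system ?B u t TB loB hiB q"
      and opp: "h \<in> TB \<longleftrightarrow> g \<notin> TA"
      by blast
    have "loB h = u"
      using edge_at_out_root[OF fin(2) sysB gE(2)] B(3) by simp
    moreover have "{u, v} = {loB h, hiB h}"
      using system_edges(3)[OF sysB gE(2)] B(3) by simp
    ultimately have h: "loB h = u" "hiB h = v"
      using uv(2) by (auto simp: doubleton_eq_iff)
    obtain r :: "'v \<Rightarrow> real" where r: "inj_on r (A \<union> B)"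
      "\<And>x y. x \<in> A \<Longrightarrow> y \<in> A \<Longrightarrow> p x < p y \<Longrightarrow> r x < r y"
      "\<And>x y. x \<in> B \<Longrightarrow> y \<in> B \<Longrightarrow> q x < q y \<Longrightarrow> r x < r y"
      using merge_positions_after[OF cAB(3,4) uv(1), of p q]
        system_edges(2)[OF sysA] system_edges(2)[OF sysB]
        out_root_first[OF fin(2) sysB] in_root_last[OF fin(1) sysA] A(1) B(1) by metis
    have "\<exists>lo hi. branching_system G s t ((TA - {g}) \<union> (TB - {h})) lo hi r"
      by (rule glue_systems[where r = r, OF V _ uv(2) E disj A(2) B(2) A(4) B(4) A(5) B(5) fin sysA sysB g h])
        (use r A(1) B(1) uv AB opp sA uvAB False in auto)
    then show ?thesis
      using finish sysB fTA by blast
  qed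
qed

end

section \<open>The induction over all circuits\<close>

context circuit
begin

lemma two_vertex_system:
  assumes c: "card V = 2" and st: "s \<in> V" "t \<in> V" "s \<noteq> t" and f: "f \<in> E"
  shows "\<exists>T lo hi pos. branching_system G s t T lo hi pos \<and> f \<notin> T"
proof -
  have V: "V = {s, t}"
    using c st card_seteq[OF finite_mg_verts, of "{s, t}"] by simp
  have "card E = 2"
    using circuit c by (simp add: generic_circuit_def)
  then obtain a b where ab: "E = {a, b}" "a \<noteq> b"
    by (auto simp: card_2_iff)
  obtain g where g: "E = {g, f}" "g \<noteq> f"
    using ab f by (cases "f = a") auto
  have ends: "ends e = {s, t}" if "e \<in> E" for e
    using card_seteq[of "{s, t}" "ends e"] mg_ends_in_verts[OF that] card_mg_ends[OF that] V st by auto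
  have "branching_system G s t {g} (\<lambda>_. s) (\<lambda>_. t) (\<lambda>x. if x = s then 0 else 1)"
    using g ends V st by (auto simp: branching_system_def bij_betw_def inj_on_def)
  then show ?thesis
    using g by blast
qed

end

context simple_circuit
begin

lemma card_V4: "4 \<le> card V"
proof -
  have "V \<noteq> {}"
    using card_V3 by auto
  then obtain z where z: "z \<in> V"
    by blast
  have "nbrs z \<subseteq> V - {z}"
    using nbrs_sub by fastforce
  then have "card (nbrs z) \<le> card (V - {z})"
    by (intro card_mono) auto
  then show ?thesis
    using card_nbrs[OF z] z card_V3 by simp
qed

lemma edge_between_if_four_vertices:
  assumes "card V = 4" "x \<in> V" "y \<in> V" "x \<noteq> y"
  obtains e where "e \<in> E" "ends e = {x, y}"
proof -
  have "nbrs x \<subseteq> V - {x}"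
    using nbrs_sub by fastforce
  then have "nbrs x = V - {x}"
    using card_nbrs[OF assms(2)] assms by (intro card_seteq) auto
  then have "y \<in> nbrs x"
    using assms by simp
  then show thesis
    using that by (auto simp: nbrs_def)
qed

text \<open>
  The complete graph on four vertices needs direct treatment, because splitting off one of its
  vertices creates parallel edges. The vertex \<open>v0\<close> is left by \<open>e03\<close> in the
  first in-branching and by \<open>e02\<close> in the second one.
\<close>

lemma four_vertex_system_of_order:
  assumes V: "V = {v0, v1, v2, v3}" "distinct [v0, v1, v2, v3]"
    and e: "ends e01 = {v0, v1}" "ends e02 = {v0, v2}" "ends e03 = {v0, v3}"
      "ends e12 = {v1, v2}" "ends e13 = {v1, v3}" "ends e23 = {v2, v3}"
    and E: "E = {e01, e02, e03, e12, e13, e23}" "distinct [e01, e02, e03, e12, e13, e23]"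
  shows "\<exists>lo hi pos. branching_system G v0 v3 {e01, e02, e13} lo hi pos"
    "\<exists>lo hi pos. branching_system G v0 v3 {e01, e12, e03} lo hi pos"
proof -
  define lo where "lo e = (if e \<in> {e01, e02, e03} then v0 else if e \<in> {e12, e13} then v1 else v2)" for e
  define hi where "hi e = (if e \<in> {e03, e13, e23} then v3 else if e \<in> {e02, e12} then v2 else v1)" for e
  define pos :: "'v \<Rightarrow> real" where "pos x = (if x = v0 then 0 else if x = v1 then 1 else if x = v2 then 2 else 3)" for x
  have lo: "lo e01 = v0" "lo e02 = v0" "lo e03 = v0" "lo e12 = v1" "lo e13 = v1" "lo e23 = v2"
    and hi: "hi e01 = v1" "hi e02 = v2" "hi e03 = v3" "hi e12 = v2" "hi e13 = v3" "hi e23 = v3"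
    and pos: "pos v0 = 0" "pos v1 = 1" "pos v2 = 2" "pos v3 = 3"
    using E V by (auto simp: lo_def hi_def pos_def)
  have 1: "inj_on pos V" "\<forall>e\<in>E. ends e = {lo e, hi e} \<and> pos (lo e) < pos (hi e)"
    using V E(1) e lo hi pos by (simp_all add: inj_on_def)
  have D: "V - {v0} = {v1, v2, v3}" "V - {v3} = {v0, v1, v2}"
    using V by auto
  have C: "E - {e01, e02, e13} = {e03, e12, e23}" "E - {e01, e12, e03} = {e02, e13, e23}"
    using E by auto
  have b: "bij_betw hi {e01, e02, e13} {v1, v2, v3}" "bij_betw lo {e03, e12, e23} {v0, v1, v2}"
    "bij_betw hi {e01, e12, e03} {v1, v2, v3}" "bij_betw lo {e02, e13, e23} {v0, v1, v2}"
    using V(2) lo hi by (auto simp: bij_betw_def)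
  have "branching_system G v0 v3 {e01, e02, e13} lo hi pos" "branching_system G v0 v3 {e01, e12, e03} lo hi pos"
    unfolding branching_system_def C D using 1 b E(1) by simp_all
  then show "\<exists>lo hi pos. branching_system G v0 v3 {e01, e02, e13} lo hi pos"
    "\<exists>lo hi pos. branching_system G v0 v3 {e01, e12, e03} lo hi pos"
    by blast+
qed

lemma four_vertex_system:
  assumes c: "card V = 4" and st: "s \<in> V" "t \<in> V" "s \<noteq> t" and f: "f \<in> E" "s \<in> ends f"
  shows "\<exists>T lo hi pos. branching_system G s t T lo hi pos \<and> f \<notin> T"
proof -
  obtain w where w: "ends f = {s, w}" "w \<in> nbrs s"
    using edge_at[OF f] by blast
  then have w': "w \<noteq> s" "w \<in> V"
    using nbrs_sub nbrs_irrefl by blast+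
  obtain a b where V: "V = {s, a, b, t}" "distinct [s, a, b, t]" "w = t \<or> w = b"
  proof -
    have "card (V - {s, t}) = 2"
      using c st by (simp add: card_Diff_subset)
    then obtain a b where ab: "V - {s, t} = {a, b}" "a \<noteq> b"
      by (auto simp: card_2_iff)
    then have V: "V = {s, a, b, t}" "V = {s, b, a, t}" "distinct [s, a, b, t]" "distinct [s, b, a, t]"
      using st by auto
    show thesis
      using that[OF V(1,3)] that[OF V(2,4)] w' V(1) by auto
  qed
  have mem: "s \<in> V" "a \<in> V" "b \<in> V" "t \<in> V" and ne: "s \<noteq> a" "s \<noteq> b" "s \<noteq> t" "a \<noteq> b" "a \<noteq> t" "b \<noteq> t"
    using V by auto
  obtain e01 where e01: "e01 \<in> E" "ends e01 = {s, a}"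
    using edge_between_if_four_vertices[OF c mem(1,2) ne(1)] .
  obtain e02 where e02: "e02 \<in> E" "ends e02 = {s, b}"
    using edge_between_if_four_vertices[OF c mem(1,3) ne(2)] .
  obtain e03 where e03: "e03 \<in> E" "ends e03 = {s, t}"
    using edge_between_if_four_vertices[OF c mem(1,4) ne(3)] .
  obtain e12 where e12: "e12 \<in> E" "ends e12 = {a, b}"
    using edge_between_if_four_vertices[OF c mem(2,3) ne(4)] .
  obtain e13 where e13: "e13 \<in> E" "ends e13 = {a, t}"
    using edge_between_if_four_vertices[OF c mem(2,4) ne(5)] .
  obtain e23 where e23: "e23 \<in> E" "ends e23 = {b, t}"
    using edge_between_if_four_vertices[OF c mem(3,4) ne(6)] .
  have dist: "distinct [e01, e02, e03, e12, e13, e23]"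
    using e01(2) e02(2) e03(2) e12(2) e13(2) e23(2) ne by (auto simp: doubleton_eq_iff)
  have "card E = 6"
    using circuit c by (simp add: generic_circuit_def)
  moreover have "card {e01, e02, e03, e12, e13, e23} = 6"
    using dist by simp
  ultimately have E: "E = {e01, e02, e03, e12, e13, e23}"
    using card_seteq[OF finite_mg_edges, of "{e01, e02, e03, e12, e13, e23}"]
      e01(1) e02(1) e03(1) e12(1) e13(1) e23(1) by simp
  note sys = four_vertex_system_of_order[OF V(1,2) e01(2) e02(2) e03(2) e12(2) e13(2) e23(2) E dist]
  show ?thesis
  proof (cases "w = t")
    case True
    then have "f = e03"
      using w(1) e03 f(1) by (simp add: inj_on_eq_iff[OF ends_inj, symmetric])
    then show ?thesis
      using sys(1) dist by auto
  next
    case False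
    then have "f = e02"
      using V(3) w(1) e02 f(1) by (simp add: inj_on_eq_iff[OF ends_inj, symmetric])
    then show ?thesis
      using sys(2) dist by auto
  qed
qed

end

lemma circuit_has_branching_system:
  assumes "generic_circuit G" "s \<in> mg_verts G" "t \<in> mg_verts G" "s \<noteq> t" "f \<in> mg_edges G" "s \<in> mg_ends G f"
  shows "\<exists>T lo hi pos. branching_system G s t T lo hi pos \<and> f \<notin> T"
  using assms
proof (induction "card (mg_verts G)" arbitrary: G s t f rule: less_induct)
  case less
  interpret circuit G by unfold_locales (rule less.prems)
  note st = less.prems(2-4) and f = less.prems(5,6)
  consider "card V = 2" | "3 \<le> card V"
    using card_V by linarith
  then show ?case
  proof cases
    case 1
    then show ?thesis
      using two_vertex_system st f(1) by blast
  next
    case 2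
    interpret simple_circuit G by unfold_locales (rule 2)
    consider "card V = 4" | A B where "two_separation G A B" | "5 \<le> card V" "\<And>A B. \<not> two_separation G A B"
      using card_V4 by force
    then show ?thesis
    proof cases
      case 1
      then show ?thesis
        using four_vertex_system st f by blast
    next
      case sep: 2
      then consider "ends f \<subseteq> A" | "ends f \<subseteq> B"
        using f(1) by (auto simp: two_separation_def)
      then show ?thesis
      proof cases
        case 1
        then show ?thesis
          using two_separation_step[OF sep st f] less.hyps by blast
      next
        case 2
        have "two_separation G B A"
          using sep two_separation_commute by metis
        from two_separation_step[OF this st f 2] show ?thesis
          using less.hyps by blast
      qed
    next
      case 3
      then interpret three_connected_circuit G
        by unfold_locales
      show ?thesis
        using admissible_step[OF st f] less.hyps st(3) by blast
    qed
  qed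
qed

theorem theorem3p2:
  fixes G :: "('v, 'e) multigraph" and s t :: 'v and e :: 'e
  assumes "generic_circuit G"
    and "s \<in> mg_verts G" and "t \<in> mg_verts G" and "s \<noteq> t"
    and "e \<in> mg_edges G" and "s \<in> mg_ends G e \<or> t \<in> mg_ends G e"
  shows "(\<exists>R Bp Bm. good_ordering G R \<and> good_branchings (orientation G R) Bp s Bm t \<and> e \<in> arcs Bp) \<and>
         (\<exists>R Bp Bm. good_ordering G R \<and> good_branchings (orientation G R) Bp s Bm t \<and> e \<in> arcs Bm)"
proof -
  have fin: "fin_multigraph G"
    using assms(1) by (simp add: generic_circuit_def)
  have free: "\<exists>T lo hi pos. branching_system G x y T lo hi pos \<and> (e \<in> T \<longleftrightarrow> b)"
    if "x \<in> mg_verts G" "y \<in> mg_verts G" "x \<noteq> y" "x \<in> mg_ends G e" for x y b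
    using system_with_first_edge_iff[OF assms(1) that(1) _ assms(5) that(4)]
      circuit_has_branching_system[OF assms(1) that(1-3)] by blast
  have sys: "\<exists>T lo hi pos. branching_system G s t T lo hi pos \<and> (e \<in> T \<longleftrightarrow> b)" for b
  proof (cases "s \<in> mg_ends G e")
    case True
    then show ?thesis
      using free assms(2-4) by blast
  next
    case False
    then have "t \<in> mg_ends G e"
      using assms(6) by blast
    then obtain T lo hi and pos :: "'v \<Rightarrow> real" where sys: "branching_system G t s T lo hi pos" and "e \<in> T \<longleftrightarrow> \<not> b"
      using free[of t s "\<not> b"] assms(2-4) by blast
    then have "e \<in> mg_edges G - T \<longleftrightarrow> b"
      using assms(5) by blast
    then show ?thesis
      using branching_system_reverse[OF sys] by blast
  qed
  have "\<exists>R Bp Bm. good_ordering G R \<and> good_branchings (orientation G R) Bp s Bm t \<and> e \<in> arcs Bp"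
  proof -
    obtain T lo hi and pos :: "'v \<Rightarrow> real" where "branching_system G s t T lo hi pos" "e \<in> T"
      using sys[of True] by blast
    then show ?thesis
      using good_branchings_of_system[OF fin assms(2,3)] by metis
  qed
  moreover have "\<exists>R Bp Bm. good_ordering G R \<and> good_branchings (orientation G R) Bp s Bm t \<and> e \<in> arcs Bm"
  proof -
    obtain T lo hi and pos :: "'v \<Rightarrow> real" where sys: "branching_system G s t T lo hi pos" and "e \<notin> T"
      using sys[of False] by blast
    then have "e \<in> mg_edges G - T"
      using assms(5) by blast
    then show ?thesis
      using good_branchings_of_system[OF fin assms(2,3) sys] by metis
  qed
  ultimately show ?thesis
    by blast
qed

end
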